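(* Let $M$ be a complete Riemannian manifold and let $\mathcal{C}$ be a closed cone field on $M$. A point $x\in M$ is stably recurrent for $\mathcal{C}$ if and only if $x$ is a singular point of $\mathcal{C}$ or there exists a point $y\neq x$ such that $y\in\mathcal{F}^+_{\mathcal{C}}(x)\cap\mathcal{F}^-_{\mathcal{C}}(x)$.
   Context: Cones. A convex cone in a finite-dimensional real vector space $E$ is a (possibly empty) convex subset $C\subset E$ with $tx\in C$ for all $t>0$, $x\in C$. It is regular if it is non-empty and there is a linear form $p$ on $E$ with $p\cdot v>0$ for all $v\in C$. A closed cone is a convex cone $C$ which is either empty, or equal to $E$ (singular), or regular with $C\cup\{0\}$ closed in $E$. Cone fields. A cone field on $M$ is a subset $\mathcal{C}\subset TM$ such that $\mathcal{C}(x):=\mathcal{C}\cap T_xM$ is a convex cone for each $x$. An open cone field is a cone field which is open in $TM$. A closed cone field is a cone field $\mathcal{C}$ such that the union of $\mathcal{C}$ and the zero section is closed in $TM$ and each $\mathcal{C}(x)$ is a closed cone. A point $x$ is singular for $\mathcal{C}$ if $\mathcal{C}(x)=T_xM$. An open enlargement of a closed cone field $\mathcal{C}$ is an open cone field $\mathcal{E}$ with $\mathcal{C}\subset\mathcal{E}$. Timelike curves. For an open cone field $\mathcal{E}$, an $\mathcal{E}$-timelike curve is a piecewise smooth curve $\gamma:I\to M$ with $\dot\gamma(t)\in\mathcal{E}(\gamma(t))$ for all $t$ (for left and right derivatives at non-smooth points). $\mathcal{I}^+_{\mathcal{E}}(x)$ is the set of $y$ such that there is a non-constant $\mathcal{E}$-timelike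 curve $\gamma:[0,T]\to M$ with $\gamma(0)=x$, $\gamma(T)=y$; and $\mathcal{I}^-_{\mathcal{E}}(x)=\{x': x\in\mathcal{I}^+_{\mathcal{E}}(x')\}$. Stable future and past: $\mathcal{F}^\pm_{\mathcal{C}}(x):=\{x\}\cup\bigcap_{\mathcal{E}}\mathcal{I}^\pm_{\mathcal{E}}(x)$, over all open enlargements $\mathcal{E}$ of $\mathcal{C}$. A point $x$ is stably recurrent for $\mathcal{C}$ if for each open enlargement $\mathcal{E}$ of $\mathcal{C}$ there is a closed $\mathcal{E}$-timelike curve passing through $x$. *)

theory Defs
  imports "HOL-Analysis.Analysis"
begin

section \<open>Smooth manifolds\<close>

text \<open>
  \<open>Ck_on k f S\<close> is used for \<open>S\<close> open, and for \<open>S\<close> relatively open in a nondegenerate compact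
  interval of the real line.  In both cases the derivative within \<open>S\<close> is unique; at the end points
  of an interval it is the one-sided derivative.
\<close>

fun Ck_on :: "nat \<Rightarrow> ('b::real_normed_vector \<Rightarrow> 'c::real_normed_vector) \<Rightarrow> 'b set \<Rightarrow> bool" where
  "Ck_on 0 f S \<longleftrightarrow> continuous_on S f"
| "Ck_on (Suc k) f S \<longleftrightarrow>
     (\<forall>x\<in>S. f differentiable (at x within S)) \<and>
     (\<forall>v. Ck_on k (\<lambda>x. frechet_derivative f (at x within S) v) S)"

definition smooth_on :: "'b::real_normed_vector set \<Rightarrow> ('b \<Rightarrow> 'c::real_normed_vector) \<Rightarrow> bool" where
  "smooth_on S f \<longleftrightarrow> (\<forall>k. Ck_on k f S)"

text \<open>
  A chart is a pair of a domain and a coordinate map; the values of the map outside the domain are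
  irrelevant.  The manifold is the whole type \<open>'a\<close>, which the classes \<open>t2_space\<close> and
  \<open>second_countable_topology\<close> make Hausdorff and second countable; its dimension is
  \<open>DIM('e)\<close>.
\<close>

type_synonym ('a, 'e) chart = "'a set \<times> ('a \<Rightarrow> 'e)"

definition is_chart :: "('a::topological_space, 'e::euclidean_space) chart \<Rightarrow> bool" where
  "is_chart c \<longleftrightarrow> open (fst c) \<and> open (snd c ` fst c) \<and>
     (\<exists>\<psi>. homeomorphism (fst c) (snd c ` fst c) (snd c) \<psi>)"

definition transition :: "('a, 'e) chart \<Rightarrow> ('a, 'e) chart \<Rightarrow> 'e \<Rightarrow> 'e" where
  "transition c c' = snd c' \<circ> inv_into (fst c) (snd c)"

definition smooth_atlas ::
    "('a::{t2_space,second_countable_topology}, 'e::euclidean_space) chart set \<Rightarrow> bool" where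
  "smooth_atlas A \<longleftrightarrow>
     (\<forall>c\<in>A. is_chart c) \<and> (\<Union>c\<in>A. fst c) = UNIV \<and>
     (\<forall>c\<in>A. \<forall>c'\<in>A. smooth_on (snd c ` (fst c \<inter> fst c')) (transition c c'))"


section \<open>The tangent bundle\<close>

text \<open>
  A tangent vector is a base point together with a family of coordinate vectors, one for each chart
  of the atlas around the base point, which transform by the derivatives of the transition maps.
  The family is set to \<open>0\<close> at all other pairs \<open>c\<close>, so that equality of tangent vectors is
  equality of the representations.
\<close>

type_synonym ('a, 'e) tvec = "'a \<times> (('a, 'e) chart \<Rightarrow> 'e)"

definition tangent_space ::
    "('a, 'e::euclidean_space) chart set \<Rightarrow> 'a \<Rightarrow> ('a, 'e) tvec set" where
  "tangent_space A x = {(y, v). y = x \<and>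
     (\<forall>c. c \<notin> A \<or> x \<notin> fst c \<longrightarrow> v c = 0) \<and>
     (\<forall>c\<in>A. \<forall>c'\<in>A. x \<in> fst c \<and> x \<in> fst c' \<longrightarrow>
        v c' = frechet_derivative (transition c c') (at (snd c x)) (v c))}"

definition tangent_bundle :: "('a, 'e::euclidean_space) chart set \<Rightarrow> ('a, 'e) tvec set" where
  "tangent_bundle A = (\<Union>x. tangent_space A x)"

definition zero_section :: "('a, 'e::euclidean_space) tvec set" where
  "zero_section = range (\<lambda>x. (x, \<lambda>_. 0))"

definition tangent_over ::
    "('a, 'e::euclidean_space) chart set \<Rightarrow> ('a, 'e) chart \<Rightarrow> ('a, 'e) tvec set" where
  "tangent_over A c = {v \<in> tangent_bundle A. fst v \<in> fst c}"

definition tcoords :: "('a, 'e) chart \<Rightarrow> ('a, 'e) tvec \<Rightarrow> 'e \<times> 'e" where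
  "tcoords c v = (snd c (fst v), snd v c)"

definition of_tcoords ::
    "('a, 'e::euclidean_space) chart set \<Rightarrow> ('a, 'e) chart \<Rightarrow> 'e \<times> 'e \<Rightarrow> ('a, 'e) tvec" where
  "of_tcoords A c = inv_into (tangent_over A c) (tcoords c)"

definition tangent_topology ::
    "('a, 'e::euclidean_space) chart set \<Rightarrow> ('a, 'e) tvec topology" where
  "tangent_topology A = topology (\<lambda>W. W \<subseteq> tangent_bundle A \<and>
     (\<forall>c\<in>A. open (tcoords c ` (W \<inter> tangent_over A c))))"

lemma inj_on_tcoords:
  assumes "smooth_atlas A" "c \<in> A"
  shows "inj_on (tcoords c) (tangent_over A c)"
proof (rule inj_onI)
  fix v w
  assume v: "v \<in> tangent_over A c" and w: "w \<in> tangent_over A c" and e: "tcoords c v = tcoords c w"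
  obtain x a y b where vw: "v = (x, a)" "w = (y, b)" by (metis surj_pair)
  have x: "x \<in> fst c" "y \<in> fst c" and c: "snd c x = snd c y" "a c = b c"
    using v w e by (auto simp: tangent_over_def tcoords_def vw)
  have "inj_on (snd c) (fst c)"
    using assms unfolding smooth_atlas_def is_chart_def
    by (meson homeomorphism_apply1 inj_on_inverseI)
  then have xy: "x = y" using x c by (auto dest: inj_onD)
  have a: "(x, a) \<in> tangent_space A x" and b: "(x, b) \<in> tangent_space A x"
    using v w unfolding tangent_over_def tangent_bundle_def tangent_space_def vw xy by blast+
  have "a c' = b c'" for c'
  proof (cases "c' \<in> A \<and> x \<in> fst c'")
    case True
    let ?D = "frechet_derivative (transition c c') (at (snd c x))"
    have "a c' = ?D (a c)" "b c' = ?D (b c)"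
      using a b True assms(2) x(1) unfolding tangent_space_def by blast+
    then show ?thesis by (simp only: c(2))
  next
    case False
    then have "a c' = 0" "b c' = 0" using a b unfolding tangent_space_def by blast+
    then show ?thesis by simp
  qed
  then show "v = w" by (auto simp: vw xy)
qed

lemma openin_tangent_topology:
  assumes "smooth_atlas A"
  shows "openin (tangent_topology A) W \<longleftrightarrow> W \<subseteq> tangent_bundle A \<and>
     (\<forall>c\<in>A. open (tcoords c ` (W \<inter> tangent_over A c)))"
proof -
  have "istopology (\<lambda>W. W \<subseteq> tangent_bundle A \<and>
     (\<forall>c\<in>A. open (tcoords c ` (W \<inter> tangent_over A c))))"
    unfolding istopology_def
  proof (intro conjI allI impI ballI)
    fix S T c
    assume S: "S \<subseteq> tangent_bundle A \<and> (\<forall>c\<in>A. open (tcoords c ` (S \<inter> tangent_over A c)))"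
      and T: "T \<subseteq> tangent_bundle A \<and> (\<forall>c\<in>A. open (tcoords c ` (T \<inter> tangent_over A c)))"
      and c: "c \<in> A"
    have "tcoords c ` ((S \<inter> tangent_over A c) \<inter> (T \<inter> tangent_over A c)) =
        tcoords c ` (S \<inter> tangent_over A c) \<inter> tcoords c ` (T \<inter> tangent_over A c)"
      by (rule inj_on_image_Int[OF inj_on_tcoords[OF assms c]]) auto
    moreover have "(S \<inter> tangent_over A c) \<inter> (T \<inter> tangent_over A c) = S \<inter> T \<inter> tangent_over A c"
      by auto
    ultimately show "open (tcoords c ` (S \<inter> T \<inter> tangent_over A c))"
      using S T c by auto
  next
    fix K c
    assume K: "\<forall>W\<in>K. W \<subseteq> tangent_bundle A \<and> (\<forall>c\<in>A. open (tcoords c ` (W \<inter> tangent_over A c)))"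
      and c: "c \<in> A"
    have "tcoords c ` (\<Union>K \<inter> tangent_over A c) = (\<Union>W\<in>K. tcoords c ` (W \<inter> tangent_over A c))"
      by auto
    then show "open (tcoords c ` (\<Union>K \<inter> tangent_over A c))" using K c by auto
  qed auto
  then show ?thesis by (simp add: tangent_topology_def)
qed


section \<open>Curves\<close>

definition smooth_curve ::
    "('a::topological_space, 'e::euclidean_space) chart set \<Rightarrow> (real \<Rightarrow> 'a) \<Rightarrow> real \<Rightarrow> real \<Rightarrow> bool" where
  "smooth_curve A \<gamma> a b \<longleftrightarrow> continuous_on {a..b} \<gamma> \<and>
     (\<forall>c\<in>A. smooth_on {t\<in>{a..b}. \<gamma> t \<in> fst c} (snd c \<circ> \<gamma>))"

definition velocity ::
    "('a, 'e::euclidean_space) chart set \<Rightarrow> (real \<Rightarrow> 'a) \<Rightarrow> real set \<Rightarrow> real \<Rightarrow> ('a, 'e) tvec" where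
  "velocity A \<gamma> S t = (\<gamma> t, \<lambda>c. if c \<in> A \<and> \<gamma> t \<in> fst c
     then vector_derivative (snd c \<circ> \<gamma>) (at t within S) else 0)"

definition piecewise :: "(real \<Rightarrow> real \<Rightarrow> bool) \<Rightarrow> real \<Rightarrow> real \<Rightarrow> bool" where
  "piecewise Q a b \<longleftrightarrow> (\<exists>(n::nat) \<tau>. \<tau> 0 = a \<and> \<tau> n = b \<and>
     (\<forall>i<n. \<tau> i < \<tau> (Suc i) \<and> Q (\<tau> i) (\<tau> (Suc i))))"

definition piecewise_smooth_curve ::
    "('a::topological_space, 'e::euclidean_space) chart set \<Rightarrow> (real \<Rightarrow> 'a) \<Rightarrow> real \<Rightarrow> real \<Rightarrow> bool" where
  "piecewise_smooth_curve A \<gamma> = piecewise (smooth_curve A \<gamma>)"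


section \<open>Complete Riemannian manifolds\<close>

definition riemannian_metric ::
    "('a, 'e::euclidean_space) chart set \<Rightarrow> (('a, 'e) tvec \<Rightarrow> ('a, 'e) tvec \<Rightarrow> real) \<Rightarrow> bool" where
  "riemannian_metric A g \<longleftrightarrow> (\<forall>c\<in>A.
     (\<forall>p\<in>snd c ` fst c.
        bilinear (\<lambda>u w. g (of_tcoords A c (p, u)) (of_tcoords A c (p, w))) \<and>
        (\<forall>u w. g (of_tcoords A c (p, u)) (of_tcoords A c (p, w)) =
               g (of_tcoords A c (p, w)) (of_tcoords A c (p, u))) \<and>
        (\<forall>u. u \<noteq> 0 \<longrightarrow> g (of_tcoords A c (p, u)) (of_tcoords A c (p, u)) > 0)) \<and>
     (\<forall>u w. smooth_on (snd c ` fst c)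
        (\<lambda>p. g (of_tcoords A c (p, u)) (of_tcoords A c (p, w)))))"

text \<open>
  In the length the velocity is taken within the whole of \<open>{a..b}\<close>; it is meaningless at the
  finitely many break points, which do not contribute to the integral.
\<close>

definition curve_length ::
    "('a, 'e::euclidean_space) chart set \<Rightarrow> (('a, 'e) tvec \<Rightarrow> ('a, 'e) tvec \<Rightarrow> real) \<Rightarrow>
     (real \<Rightarrow> 'a) \<Rightarrow> real \<Rightarrow> real \<Rightarrow> real" where
  "curve_length A g \<gamma> a b =
     integral {a..b} (\<lambda>t. sqrt (g (velocity A \<gamma> {a..b} t) (velocity A \<gamma> {a..b} t)))"

text \<open>The manifold need not be connected: between different components the distance is \<open>\<infinity>\<close>.\<close>

definition riemannian_dist ::
    "('a::topological_space, 'e::euclidean_space) chart set \<Rightarrow>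
     (('a, 'e) tvec \<Rightarrow> ('a, 'e) tvec \<Rightarrow> real) \<Rightarrow> 'a \<Rightarrow> 'a \<Rightarrow> ereal" where
  "riemannian_dist A g x y =
     Inf {ereal (curve_length A g \<gamma> 0 1) |\<gamma>.
       piecewise_smooth_curve A \<gamma> 0 1 \<and> \<gamma> 0 = x \<and> \<gamma> 1 = y}"

definition complete_riemannian_manifold ::
    "('a::{t2_space,second_countable_topology}, 'e::euclidean_space) chart set \<Rightarrow>
     (('a, 'e) tvec \<Rightarrow> ('a, 'e) tvec \<Rightarrow> real) \<Rightarrow> bool" where
  "complete_riemannian_manifold A g \<longleftrightarrow> smooth_atlas A \<and> riemannian_metric A g \<and>
     (\<forall>u :: nat \<Rightarrow> 'a.
        (\<forall>\<epsilon>>0. \<exists>N. \<forall>m\<ge>N. \<forall>n\<ge>N. riemannian_dist A g (u m) (u n) < \<epsilon>) \<longrightarrow>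
        (\<exists>x. (\<lambda>n. riemannian_dist A g (u n) x) \<longlonglongrightarrow> 0))"


section \<open>Cones and cone fields\<close>

text \<open>
  Here cones may be empty and need not contain \<open>0\<close>, unlike for the constant \<open>convex_cone\<close>
  of HOL-Analysis.
\<close>

definition cvx_cone :: "'e::real_vector set \<Rightarrow> bool" where
  "cvx_cone K \<longleftrightarrow> convex K \<and> (\<forall>t>0. \<forall>x\<in>K. t *\<^sub>R x \<in> K)"

definition regular_cone :: "'e::real_vector set \<Rightarrow> bool" where
  "regular_cone K \<longleftrightarrow> cvx_cone K \<and> K \<noteq> {} \<and> (\<exists>p :: 'e \<Rightarrow> real. linear p \<and> (\<forall>v\<in>K. p v > 0))"

definition closed_cone :: "'e::euclidean_space set \<Rightarrow> bool" where
  "closed_cone K \<longleftrightarrow> cvx_cone K \<and>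
     (K = {} \<or> K = UNIV \<or> (regular_cone K \<and> closed (K \<union> {0})))"

text \<open>
  The vector space structure of a tangent space is the one for which the coordinates
  \<open>v \<mapsto> snd v c\<close> in the charts around the base point are linear isomorphisms onto \<open>'e\<close>, so
  that a property of cones is imposed on a fibre by imposing it on the coordinate images.
\<close>

definition fibre_coords ::
    "('a, 'e::euclidean_space) chart set \<Rightarrow> ('a, 'e) chart \<Rightarrow> 'a \<Rightarrow> ('a, 'e) tvec set \<Rightarrow> 'e set" where
  "fibre_coords A c x C = (\<lambda>v. snd v c) ` (C \<inter> tangent_space A x)"

definition cone_field ::
    "('a, 'e::euclidean_space) chart set \<Rightarrow> ('a, 'e) tvec set \<Rightarrow> bool" where
  "cone_field A C \<longleftrightarrow> C \<subseteq> tangent_bundle A \<and>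
     (\<forall>c\<in>A. \<forall>x\<in>fst c. cvx_cone (fibre_coords A c x C))"

definition open_cone_field ::
    "('a, 'e::euclidean_space) chart set \<Rightarrow> ('a, 'e) tvec set \<Rightarrow> bool" where
  "open_cone_field A E \<longleftrightarrow> cone_field A E \<and> openin (tangent_topology A) E"

definition closed_cone_field ::
    "('a, 'e::euclidean_space) chart set \<Rightarrow> ('a, 'e) tvec set \<Rightarrow> bool" where
  "closed_cone_field A C \<longleftrightarrow> cone_field A C \<and>
     closedin (tangent_topology A) (C \<union> zero_section) \<and>
     (\<forall>c\<in>A. \<forall>x\<in>fst c. closed_cone (fibre_coords A c x C))"

definition singular_point ::
    "('a, 'e::euclidean_space) chart set \<Rightarrow> ('a, 'e) tvec set \<Rightarrow> 'a \<Rightarrow> bool" where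
  "singular_point A C x \<longleftrightarrow> C \<inter> tangent_space A x = tangent_space A x"

definition open_enlargement ::
    "('a, 'e::euclidean_space) chart set \<Rightarrow> ('a, 'e) tvec set \<Rightarrow> ('a, 'e) tvec set \<Rightarrow> bool" where
  "open_enlargement A C E \<longleftrightarrow> open_cone_field A E \<and> C \<subseteq> E"


section \<open>Timelike curves and stable recurrence\<close>

definition timelike_curve ::
    "('a::topological_space, 'e::euclidean_space) chart set \<Rightarrow> ('a, 'e) tvec set \<Rightarrow>
     (real \<Rightarrow> 'a) \<Rightarrow> real \<Rightarrow> real \<Rightarrow> bool" where
  "timelike_curve A E \<gamma> = piecewise (\<lambda>s r. smooth_curve A \<gamma> s r \<and>
     (\<forall>t\<in>{s..r}. velocity A \<gamma> {s..r} t \<in> E))"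

definition chron_future ::
    "('a::topological_space, 'e::euclidean_space) chart set \<Rightarrow> ('a, 'e) tvec set \<Rightarrow> 'a \<Rightarrow> 'a set" where
  "chron_future A E x = {y. \<exists>\<gamma> T. timelike_curve A E \<gamma> 0 T \<and>
     (\<exists>s\<in>{0..T}. \<exists>t\<in>{0..T}. \<gamma> s \<noteq> \<gamma> t) \<and> \<gamma> 0 = x \<and> \<gamma> T = y}"

definition chron_past ::
    "('a::topological_space, 'e::euclidean_space) chart set \<Rightarrow> ('a, 'e) tvec set \<Rightarrow> 'a \<Rightarrow> 'a set" where
  "chron_past A E x = {x'. x \<in> chron_future A E x'}"

definition stable_future ::
    "('a::topological_space, 'e::euclidean_space) chart set \<Rightarrow> ('a, 'e) tvec set \<Rightarrow> 'a \<Rightarrow> 'a set" where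
  "stable_future A C x = {x} \<union> (\<Inter>E\<in>{E. open_enlargement A C E}. chron_future A E x)"

definition stable_past ::
    "('a::topological_space, 'e::euclidean_space) chart set \<Rightarrow> ('a, 'e) tvec set \<Rightarrow> 'a \<Rightarrow> 'a set" where
  "stable_past A C x = {x} \<union> (\<Inter>E\<in>{E. open_enlargement A C E}. chron_past A E x)"

definition stably_recurrent ::
    "('a::topological_space, 'e::euclidean_space) chart set \<Rightarrow> ('a, 'e) tvec set \<Rightarrow> 'a \<Rightarrow> bool" where
  "stably_recurrent A C x \<longleftrightarrow> (\<forall>E. open_enlargement A C E \<longrightarrow>
     (\<exists>\<gamma> T. T > 0 \<and> timelike_curve A E \<gamma> 0 T \<and> \<gamma> 0 = \<gamma> T \<and> (\<exists>t\<in>{0..T}. \<gamma> t = x)))"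

end

theory Submission
  imports Defs
begin

text \<open>
  If \<open>x\<close> is stably recurrent but not singular, then near \<open>x\<close> the cones of
  a small enlargement lie in a fixed convex cone without \<open>0\<close>, so a closed timelike
  curve through \<open>x\<close> cannot stay in a small chart ball around \<open>x\<close>; it meets
  the bounding sphere in a point that is both reachable from \<open>x\<close> and leads back to
  \<open>x\<close>. Enlargements are closed under finite intersections, so by compactness some
  \<open>y\<close> on the sphere is a limit of such points for every enlargement. That
  \<open>y\<close> itself is such a point for a given \<open>\<E>\<close> is seen by passing to a
  smaller enlargement whose cones near \<open>y\<close> lie in a slightly smaller constant cone
  \<open>\<Omega>\<close>: the displacement along a timelike curve near \<open>y\<close> lies in
  \<open>\<Omega>\<close>, so the part of the curve near \<open>y\<close> can be replaced by a
  straight \<open>\<E>\<close>-timelike segment that ends exactly at \<open>y\<close>.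
\<close>

section \<open>Smooth functions and curves in charts\<close>

text \<open>One \<open>y\<close> has to serve all enlargements, but the points found on the sphere
  depend on the enlargement, and the sets of such points need not be closed. So compactness is
  applied to their closures, on a sphere whose radius is fixed independently of the enlargement.
  Removing the closure is where a quantitative margin is needed: \<Omega> fits into the given
  enlargement with a slack proportional to the length of the vector. As \<open>x\<close> is kept
  outside the ball around \<open>y\<close>, the curve crosses the bounding sphere; this makes the
  displacement long compared with the distance of its end from \<open>y\<close>, and the end may be
  moved. If \<open>y\<close> is itself singular, there is no such \<Omega>, but then the enlargement
  contains all vectors over a neighbourhood of \<open>y\<close> and every segment there is timelike.
  Conversely, curves from \<open>x\<close> to \<open>y\<close> and back join to a closed curve. A
  singular \<open>x\<close> is recurrent because constant curves are timelike where the zero vector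
  is allowed.\<close>

lemma frechet_derivative_cong_on:
  assumes "x \<in> S" "\<And>y. y \<in> S \<Longrightarrow> f y = g y"
  shows "frechet_derivative f (at x within S) = frechet_derivative g (at x within S)"
proof -
  have "(f has_derivative D) (at x within S) \<longleftrightarrow> (g has_derivative D) (at x within S)" for D
    using assms by (metis has_derivative_transform)
  then show ?thesis by (simp add: frechet_derivative_def)
qed

lemma Ck_on_cong:
  assumes "\<And>x. x \<in> S \<Longrightarrow> f x = g x"
  shows "Ck_on k f S \<longleftrightarrow> Ck_on k g S"
  using assms
proof (induction k arbitrary: f g)
  case 0
  then show ?case by (simp cong: continuous_on_cong)
next
  case (Suc k)
  have "f differentiable (at x within S) \<longleftrightarrow> g differentiable (at x within S)" if "x \<in> S" for x
    using Suc.prems that unfolding differentiable_def by (metis has_derivative_transform)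
  moreover have "Ck_on k (\<lambda>x. frechet_derivative f (at x within S) v) S \<longleftrightarrow>
      Ck_on k (\<lambda>x. frechet_derivative g (at x within S) v) S" for v
    by (rule Suc.IH) (simp add: frechet_derivative_cong_on[OF _ Suc.prems])
  ultimately show ?case by simp
qed

text \<open>\<open>frechet_derivative\<close> is a choice and is determined only where derivatives
  are unique. For a real parameter it is enough that the point is not isolated in \<open>S\<close>,
  since a linear map on the line is fixed by its value at 1.\<close>

lemma frechet_derivative_within_eq:
  fixes f :: "real \<Rightarrow> 'b::real_normed_vector"
  assumes "(f has_derivative D) (at x within S)" "at x within S \<noteq> bot"
  shows "frechet_derivative f (at x within S) = D"
proof -
  let ?F = "frechet_derivative f (at x within S)"
  have F: "(f has_derivative ?F) (at x within S)"
    using assms(1) differentiableI frechet_derivative_works by blast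
  have scale: "H v = v *\<^sub>R H 1" if "(f has_derivative H) (at x within S)" for H v
    using linear_scale[OF has_derivative_linear[OF that], of v 1] by simp
  have vec: "(f has_vector_derivative H 1) (at x within S)"
    if "(f has_derivative H) (at x within S)" for H
  proof -
    have "H = (\<lambda>v. v *\<^sub>R H 1)" using scale[OF that] by (rule ext)
    then show ?thesis using that by (simp add: has_vector_derivative_def)
  qed
  have "?F 1 = D 1"
    using vector_derivative_unique_within[OF assms(2) vec[OF F] vec[OF assms(1)]] .
  then show ?thesis using scale[OF F] scale[OF assms(1)] by (metis ext)
qed

text \<open>
  With \<open>d = 1\<close> this covers translations of the parameter and restrictions to a smaller domain,
  in general it covers straight segments.
\<close>

lemma Ck_on_compose_affine:
  fixes f :: "'b::real_normed_vector \<Rightarrow> 'c::real_normed_vector" and T :: "real set"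
  assumes "Ck_on k f S" "\<And>t. t \<in> T \<Longrightarrow> a + t *\<^sub>R d \<in> S" "\<And>t. t \<in> T \<Longrightarrow> at t within T \<noteq> bot"
  shows "Ck_on k (\<lambda>t. f (a + t *\<^sub>R d)) T"
  using assms(1)
proof (induction k arbitrary: f)
  case 0
  have "continuous_on T (\<lambda>t. a + t *\<^sub>R d)" by (intro continuous_intros)
  then show ?case using 0 assms(2) by (auto intro: continuous_on_compose2)
next
  case (Suc k)
  let ?F = "\<lambda>p. frechet_derivative f (at p within S)"
  have D: "((\<lambda>t. f (a + t *\<^sub>R d)) has_derivative (\<lambda>v. ?F (a + t *\<^sub>R d) (v *\<^sub>R d))) (at t within T)"
    if t: "t \<in> T" for t
  proof (rule has_derivative_in_compose2[where t = S])
    show "\<And>x. x \<in> S \<Longrightarrow> (f has_derivative ?F x) (at x within S)"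
      using Suc.prems frechet_derivative_works by auto
    show "((\<lambda>t. a + t *\<^sub>R d) has_derivative (\<lambda>v. v *\<^sub>R d)) (at t within T)"
      by (auto intro!: derivative_eq_intros)
  qed (use assms(2) t in auto)
  have eq: "frechet_derivative (\<lambda>t. f (a + t *\<^sub>R d)) (at t within T) v = ?F (a + t *\<^sub>R d) (v *\<^sub>R d)"
    if "t \<in> T" for t v
    using frechet_derivative_within_eq[OF D[OF that] assms(3)[OF that]] by simp
  have "Ck_on k (\<lambda>t. ?F (a + t *\<^sub>R d) (v *\<^sub>R d)) T" for v
    using Suc.prems by (intro Suc.IH) auto
  then have "Ck_on k (\<lambda>t. frechet_derivative (\<lambda>t. f (a + t *\<^sub>R d)) (at t within T) v) T" for v
    by (subst Ck_on_cong[OF eq]) simp_all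
  moreover have "(\<lambda>t. f (a + t *\<^sub>R d)) differentiable (at t within T)" if "t \<in> T" for t
    using D[OF that] differentiableI by blast
  ultimately show ?case by simp
qed

lemma smooth_on_cong:
  assumes "\<And>x. x \<in> S \<Longrightarrow> f x = g x"
  shows "smooth_on S f \<longleftrightarrow> smooth_on S g"
  using Ck_on_cong[of S f g] assms by (simp add: smooth_on_def)

lemma smooth_on_compose_affine:
  fixes T :: "real set"
  assumes "smooth_on S f" "\<And>t. t \<in> T \<Longrightarrow> a + t *\<^sub>R d \<in> S" "\<And>t. t \<in> T \<Longrightarrow> at t within T \<noteq> bot"
  shows "smooth_on T (\<lambda>t. f (a + t *\<^sub>R d))"
  using assms Ck_on_compose_affine unfolding smooth_on_def by blast

text \<open>\<open>smooth_curve\<close> differentiates within the part of the interval that lies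
  over a chart domain, \<open>velocity\<close> within the whole interval. That part is relatively
  open, so the two filters agree.\<close>

lemma at_within_Collect_open:
  fixes \<gamma> :: "real \<Rightarrow> 'a::topological_space"
  assumes "continuous_on {a..b} \<gamma>" "open U" "t \<in> {a..b}" "\<gamma> t \<in> U"
  shows "at t within {t\<in>{a..b}. \<gamma> t \<in> U} = at t within {a..b}"
proof -
  obtain V where V: "open V" "V \<inter> {a..b} = \<gamma> -` U \<inter> {a..b}"
    using assms(1,2) unfolding continuous_on_open_invariant by metis
  show ?thesis
  proof (rule at_within_nhd[of _ V])
    show "t \<in> V" using V(2) assms(3,4) by blast
    show "{t \<in> {a..b}. \<gamma> t \<in> U} \<inter> V - {t} = {a..b} \<inter> V - {t}" using V(2) by blast
  qed (rule V(1))
qed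

lemma at_within_Icc_neq_bot: "a < b \<Longrightarrow> t \<in> {a..b} \<Longrightarrow> at t within {a..b::real} \<noteq> bot"
  using islimpt_Icc trivial_limit_within by blast

lemma at_within_Collect_open_neq_bot:
  fixes \<gamma> :: "real \<Rightarrow> 'a::topological_space"
  assumes "continuous_on {a..b} \<gamma>" "open U" "a < b" "t \<in> {t\<in>{a..b}. \<gamma> t \<in> U}"
  shows "at t within {t\<in>{a..b}. \<gamma> t \<in> U} \<noteq> bot"
  using at_within_Collect_open[OF assms(1,2)] at_within_Icc_neq_bot assms(3,4) by simp

section \<open>Charts and transition maps\<close>

lemma chartD:
  assumes "smooth_atlas A" "c \<in> A"
  shows "open (fst c)" "open (snd c ` fst c)" "inj_on (snd c) (fst c)"
    "continuous_on (fst c) (snd c)" "continuous_on (snd c ` fst c) (inv_into (fst c) (snd c))"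
proof -
  obtain \<psi> where \<psi>: "homeomorphism (fst c) (snd c ` fst c) (snd c) \<psi>"
    and o: "open (fst c)" "open (snd c ` fst c)"
    using assms unfolding smooth_atlas_def is_chart_def by blast
  show "open (fst c)" "open (snd c ` fst c)" by fact+
  show inj: "inj_on (snd c) (fst c)" using \<psi> by (meson homeomorphism_apply1 inj_on_inverseI)
  show "continuous_on (fst c) (snd c)" using \<psi> homeomorphism_cont1 by blast
  have "inv_into (fst c) (snd c) p = \<psi> p" if "p \<in> snd c ` fst c" for p
  proof -
    obtain y where "y \<in> fst c" "p = snd c y" using \<open>p \<in> snd c ` fst c\<close> by blast
    then show ?thesis using inj homeomorphism_apply1[OF \<psi>] by (simp add: inv_into_f_f)
  qed
  then show "continuous_on (snd c ` fst c) (inv_into (fst c) (snd c))"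
    using homeomorphism_cont2[OF \<psi>] continuous_on_cong by metis
qed

lemma open_chart_image:
  assumes "smooth_atlas A" "c \<in> A" "open U"
  shows "open (snd c ` (fst c \<inter> U))"
proof -
  let ?\<psi> = "inv_into (fst c) (snd c)"
  note ch = chartD[OF assms(1,2)]
  have "open (snd c ` fst c \<inter> ?\<psi> -` U)"
    using continuous_open_preimage[OF ch(5,2) assms(3)] .
  moreover have "snd c ` fst c \<inter> ?\<psi> -` U = snd c ` (fst c \<inter> U)"
    using ch(3) by (auto simp: inv_into_f_f)
  ultimately show ?thesis by simp
qed

lemma chart_ex:
  assumes "smooth_atlas A"
  obtains c where "c \<in> A" "x \<in> fst c"
  using assms unfolding smooth_atlas_def by blast

lemma transition_smooth:
  assumes "smooth_atlas A" "c \<in> A" "c' \<in> A"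
  shows "smooth_on (snd c ` (fst c \<inter> fst c')) (transition c c')"
  using assms unfolding smooth_atlas_def by blast

lemma transition_apply:
  assumes "smooth_atlas A" "c \<in> A" "x \<in> fst c"
  shows "transition c c' (snd c x) = snd c' x"
  using chartD(3)[OF assms(1,2)] assms(3) by (simp add: transition_def)

lemma transition_has_derivative:
  assumes "smooth_atlas A" "c \<in> A" "c' \<in> A" "x \<in> fst c" "x \<in> fst c'"
  shows "(transition c c' has_derivative frechet_derivative (transition c c') (at (snd c x))) (at (snd c x))"
proof -
  have o: "open (snd c ` (fst c \<inter> fst c'))"
    using open_chart_image[OF assms(1,2)] chartD(1)[OF assms(1,3)] by blast
  have "Ck_on 1 (transition c c') (snd c ` (fst c \<inter> fst c'))"
    using transition_smooth[OF assms(1-3)] unfolding smooth_on_def by blast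
  then have "transition c c' differentiable (at (snd c x) within snd c ` (fst c \<inter> fst c'))"
    using assms(4,5) by auto
  then have "transition c c' differentiable (at (snd c x))"
    using at_within_open[OF _ o, of "snd c x"] assms(4,5) by auto
  then show ?thesis using frechet_derivative_works by blast
qed

lemma transition_continuous_derivative:
  assumes "smooth_atlas A" "c \<in> A" "c' \<in> A"
  shows "continuous_on (snd c ` (fst c \<inter> fst c')) (\<lambda>p. frechet_derivative (transition c c') (at p) v)"
proof -
  let ?S = "snd c ` (fst c \<inter> fst c')"
  have o: "open ?S" using open_chart_image[OF assms(1,2)] chartD(1)[OF assms(1,3)] by blast
  have "Ck_on (Suc 0) (transition c c') ?S"
    using transition_smooth[OF assms(1-3)] unfolding smooth_on_def by blast
  then have "continuous_on ?S (\<lambda>p. frechet_derivative (transition c c') (at p within ?S) v)" by auto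
  then show ?thesis by (rule continuous_on_eq) (use at_within_open[OF _ o] in auto)
qed

section \<open>Velocities of curves in coordinates\<close>

lemma smooth_curve_has_vector_derivative:
  assumes "smooth_atlas A" "smooth_curve A \<gamma> a b" "t \<in> {a..b}" "c \<in> A" "\<gamma> t \<in> fst c"
  shows "(snd c \<circ> \<gamma> has_vector_derivative snd (velocity A \<gamma> {a..b} t) c) (at t within {a..b})"
proof -
  let ?T = "{t\<in>{a..b}. \<gamma> t \<in> fst c}"
  have "Ck_on 1 (snd c \<circ> \<gamma>) ?T" using assms unfolding smooth_curve_def smooth_on_def by blast
  then have "(snd c \<circ> \<gamma>) differentiable (at t within ?T)" using assms by auto
  then have "(snd c \<circ> \<gamma>) differentiable (at t within {a..b})"
    using at_within_Collect_open[of a b \<gamma> "fst c" t] chartD(1)[OF assms(1,4)] assms(2,3,5)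
    by (simp add: smooth_curve_def)
  then show ?thesis using assms(4,5) by (simp add: velocity_def vector_derivative_works)
qed

text \<open>Chain rule through the transition maps. By injectivity of \<open>tcoords\<close>, a
  velocity can then be recognised from its coordinates in a single chart.\<close>

lemma velocity_in_tangent_space:
  assumes A: "smooth_atlas A" and \<gamma>: "smooth_curve A \<gamma> a b" and t: "a < b" "t \<in> {a..b}"
  shows "velocity A \<gamma> {a..b} t \<in> tangent_space A (\<gamma> t)"
proof -
  let ?v = "velocity A \<gamma> {a..b} t"
  have "snd ?v c' = frechet_derivative (transition c c') (at (snd c (\<gamma> t))) (snd ?v c)"
    if c: "c \<in> A" "c' \<in> A" "\<gamma> t \<in> fst c" "\<gamma> t \<in> fst c'" for c c'
  proof -
    let ?D = "frechet_derivative (transition c c') (at (snd c (\<gamma> t)))"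
    let ?T = "{t\<in>{a..b}. \<gamma> t \<in> fst c}"
    have T: "at t within ?T = at t within {a..b}"
      using at_within_Collect_open[of a b \<gamma> "fst c" t] chartD(1)[OF A c(1)] t(2) c(3) \<gamma>
      by (simp add: smooth_curve_def)
    have "(snd c \<circ> \<gamma> has_derivative (\<lambda>h. h *\<^sub>R snd ?v c)) (at t within {a..b})"
      using smooth_curve_has_vector_derivative[OF A \<gamma> t(2) c(1,3)]
      by (simp add: has_vector_derivative_def)
    from has_derivative_compose[OF this, of "transition c c'"]
    have "((\<lambda>s. transition c c' ((snd c \<circ> \<gamma>) s)) has_derivative (\<lambda>h. ?D (h *\<^sub>R snd ?v c)))
        (at t within ?T)"
      using transition_has_derivative[OF A c] T by simp
    then have "((snd c' \<circ> \<gamma>) has_derivative (\<lambda>h. ?D (h *\<^sub>R snd ?v c))) (at t within ?T)"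
      by (rule has_derivative_transform[rotated 2]) (use t c transition_apply[OF A c(1)] in auto)
    moreover have "?D (h *\<^sub>R snd ?v c) = h *\<^sub>R ?D (snd ?v c)" for h
      using linear_scale[OF has_derivative_linear[OF transition_has_derivative[OF A c]]] .
    ultimately have "(snd c' \<circ> \<gamma> has_vector_derivative ?D (snd ?v c)) (at t within {a..b})"
      using T by (simp add: has_vector_derivative_def)
    from vector_derivative_unique_within[OF at_within_Icc_neq_bot[OF t]
        smooth_curve_has_vector_derivative[OF A \<gamma> t(2) c(2,4)] this]
    show ?thesis .
  qed
  then have "\<forall>c\<in>A. \<forall>c'\<in>A. \<gamma> t \<in> fst c \<and> \<gamma> t \<in> fst c' \<longrightarrow>
      snd ?v c' = frechet_derivative (transition c c') (at (snd c (\<gamma> t))) (snd ?v c)"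
    by blast
  moreover have "\<forall>c. c \<notin> A \<or> \<gamma> t \<notin> fst c \<longrightarrow> snd ?v c = 0" "fst ?v = \<gamma> t"
    by (simp_all add: velocity_def)
  ultimately show ?thesis unfolding tangent_space_def mem_Collect_eq case_prod_unfold by blast
qed

section \<open>Timelike curves\<close>

text \<open>With the break points read as a chain of steps, concatenation is transitivity and
  induction runs over the last piece. Chains of length zero are allowed, so
  \<open>piecewise Q a a\<close> always holds.\<close>

lemma piecewise_iff_rtranclp: "piecewise Q a b \<longleftrightarrow> (\<lambda>s r. s < r \<and> Q s r)\<^sup>*\<^sup>* a b"
  by (simp add: piecewise_def rtranclp_power relpowp_fun_conv)

lemma piecewise_single: "a < b \<Longrightarrow> Q a b \<Longrightarrow> piecewise Q a b"
  by (simp add: piecewise_iff_rtranclp r_into_rtranclp)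

lemma piecewise_trans: "piecewise Q a b \<Longrightarrow> piecewise Q b c \<Longrightarrow> piecewise Q a c"
  unfolding piecewise_iff_rtranclp by (rule rtranclp_trans)

lemma piecewise_induct [consumes 1, case_names refl step]:
  assumes "piecewise Q a b" "P a"
    "\<And>b c. piecewise Q a b \<Longrightarrow> b < c \<Longrightarrow> Q b c \<Longrightarrow> P b \<Longrightarrow> P c"
  shows "P b"
  using assms unfolding piecewise_iff_rtranclp by (induction rule: rtranclp_induct) auto

lemma piecewise_le: "piecewise Q a b \<Longrightarrow> a \<le> b"
  by (induction rule: piecewise_induct) auto

lemma piecewise_mono:
  assumes "piecewise Q a b"
    "\<And>s r. a \<le> s \<Longrightarrow> s < r \<Longrightarrow> r \<le> b \<Longrightarrow> Q s r \<Longrightarrow> Q' s r"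
  shows "piecewise Q' a b"
  using assms
proof (induction rule: piecewise_induct)
  case refl
  then show ?case by (simp add: piecewise_iff_rtranclp)
next
  case (step b c)
  have "piecewise Q' a b" by (rule step.IH) (use step in auto)
  moreover have "piecewise Q' b c"
    using step piecewise_le by (intro piecewise_single) auto
  ultimately show ?case by (rule piecewise_trans)
qed

lemma piecewise_subinterval:
  assumes "piecewise Q a b" "a \<le> s" "s < r" "r \<le> b"
    and Q: "\<And>s r s' r'. Q s r \<Longrightarrow> s \<le> s' \<Longrightarrow> s' < r' \<Longrightarrow> r' \<le> r \<Longrightarrow> Q s' r'"
  shows "piecewise Q s r"
  using assms(1-4)
proof (induction arbitrary: s r rule: piecewise_induct)
  case refl
  then show ?case by simp
next
  case (step b c)
  \<comment> \<open>Position of the window \<open>{s..r}\<close> relative to the last break point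
    \<open>b\<close>; it has to be cut only if \<open>b\<close> is in its interior.\<close>
  consider "r \<le> b" | "b \<le> s" | "s < b" "b < r" by linarith
  then show ?case
  proof cases
    case 2
    then show ?thesis using step.prems step.hyps Q[of b c s r] by (intro piecewise_single) auto
  next
    case 3
    then have "piecewise Q s b" "piecewise Q b r"
      using step.prems step.hyps Q[of b c b r] step.IH[of s b] by (auto intro: piecewise_single)
    then show ?thesis by (rule piecewise_trans)
  qed (use step in auto)
qed

lemma piecewise_translate:
  assumes "piecewise Q a b" and Q: "\<And>s r. s < r \<Longrightarrow> Q s r \<Longrightarrow> Q' (s + d) (r + d)"
  shows "piecewise Q' (a + d) (b + d)"
  using assms(1)
proof (induction rule: piecewise_induct)
  case refl
  then show ?case by (simp add: piecewise_iff_rtranclp)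
next
  case (step b c)
  then show ?case using Q[of b c] by (intro piecewise_trans[OF step.IH] piecewise_single) auto
qed

section \<open>Cutting, shifting and gluing timelike pieces\<close>

definition timelike_piece ::
    "('a::topological_space, 'e::euclidean_space) chart set \<Rightarrow> ('a, 'e) tvec set \<Rightarrow>
     (real \<Rightarrow> 'a) \<Rightarrow> real \<Rightarrow> real \<Rightarrow> bool" where
  "timelike_piece A E \<gamma> s r \<longleftrightarrow>
     smooth_curve A \<gamma> s r \<and> (\<forall>t\<in>{s..r}. velocity A \<gamma> {s..r} t \<in> E)"

lemma timelike_curve_pieces: "timelike_curve A E \<gamma> = piecewise (timelike_piece A E \<gamma>)"
  by (simp add: timelike_curve_def timelike_piece_def[abs_def])

text \<open>The velocity is one-sided at the ends of a piece and depends only on the values on the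
  closed piece. Hence curves that merely agree at a junction can be glued there.\<close>

lemma timelike_piece_cong:
  assumes "\<And>t. t \<in> {s..r} \<Longrightarrow> \<gamma> t = \<gamma>' t" "timelike_piece A E \<gamma> s r"
  shows "timelike_piece A E \<gamma>' s r"
proof -
  have "smooth_on {t\<in>{s..r}. \<gamma>' t \<in> fst c} (snd c \<circ> \<gamma>')" if "c \<in> A" for c
  proof -
    have "{t\<in>{s..r}. \<gamma>' t \<in> fst c} = {t\<in>{s..r}. \<gamma> t \<in> fst c}" using assms(1) by auto
    moreover have "smooth_on {t\<in>{s..r}. \<gamma> t \<in> fst c} (snd c \<circ> \<gamma>) \<longleftrightarrow>
        smooth_on {t\<in>{s..r}. \<gamma> t \<in> fst c} (snd c \<circ> \<gamma>')"
      by (rule smooth_on_cong) (use assms(1) in simp)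
    ultimately show ?thesis
      using assms(2) that by (simp add: timelike_piece_def smooth_curve_def)
  qed
  moreover have "continuous_on {s..r} \<gamma>'"
    using assms by (auto simp: timelike_piece_def smooth_curve_def intro: continuous_on_eq)
  moreover have "velocity A \<gamma>' {s..r} t = velocity A \<gamma> {s..r} t" if t: "t \<in> {s..r}" for t
  proof -
    have "(snd c \<circ> \<gamma> has_vector_derivative D) (at t within {s..r}) \<longleftrightarrow>
        (snd c \<circ> \<gamma>' has_vector_derivative D) (at t within {s..r})" for c :: "('a, 'b) chart" and D
      using t assms(1) unfolding has_vector_derivative_def
      by (auto intro: has_derivative_transform[rotated 2])
    then have "vector_derivative (snd c \<circ> \<gamma>') (at t within {s..r}) =
        vector_derivative (snd c \<circ> \<gamma>) (at t within {s..r})" for c :: "('a, 'b) chart"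
      by (simp add: vector_derivative_def)
    then show ?thesis using assms(1)[OF t] by (simp add: velocity_def fun_eq_iff del: split_paired_All)
  qed
  ultimately show ?thesis using assms(2) by (simp add: timelike_piece_def smooth_curve_def)
qed

text \<open>Shift of the parameter and passage to a shorter piece in one; with \<open>d = 0\<close>
  only the second remains. The velocities are unchanged because the new piece is non-degenerate, so
  that derivatives within it are unique.\<close>

lemma timelike_piece_translate:
  assumes A: "smooth_atlas A" and p: "timelike_piece A E \<gamma> a b"
    and sr: "s < r" "a \<le> d + s" "d + r \<le> b"
  shows "timelike_piece A E (\<lambda>t. \<gamma> (d + t)) s r"
proof -
  have \<gamma>: "smooth_curve A \<gamma> a b" and V: "\<And>t. t \<in> {a..b} \<Longrightarrow> velocity A \<gamma> {a..b} t \<in> E"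
    using p by (auto simp: timelike_piece_def)
  have cont: "continuous_on {s..r} (\<lambda>t. \<gamma> (d + t))"
    by (rule continuous_on_compose2[of "{a..b}" \<gamma>])
      (use \<gamma> sr in \<open>auto simp: smooth_curve_def intro!: continuous_intros\<close>)
  have "smooth_on {t\<in>{s..r}. \<gamma> (d + t) \<in> fst c} (snd c \<circ> (\<lambda>t. \<gamma> (d + t)))" if c: "c \<in> A" for c
  proof -
    have "smooth_on {t\<in>{s..r}. \<gamma> (d + t) \<in> fst c} (\<lambda>t. (snd c \<circ> \<gamma>) (d + t *\<^sub>R 1))"
    proof (rule smooth_on_compose_affine[where S = "{t\<in>{a..b}. \<gamma> t \<in> fst c}"])
      show "smooth_on {t \<in> {a..b}. \<gamma> t \<in> fst c} (snd c \<circ> \<gamma>)"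
        using \<gamma> c by (simp add: smooth_curve_def)
      show "at t within {t \<in> {s..r}. \<gamma> (d + t) \<in> fst c} \<noteq> bot"
        if "t \<in> {t \<in> {s..r}. \<gamma> (d + t) \<in> fst c}" for t
        using at_within_Collect_open_neq_bot[OF cont chartD(1)[OF A c] sr(1) that] .
    qed (use sr in auto)
    then show ?thesis by (simp add: comp_def)
  qed
  moreover have "velocity A (\<lambda>t. \<gamma> (d + t)) {s..r} t = velocity A \<gamma> {a..b} (d + t)"
    if t: "t \<in> {s..r}" for t
  proof -
    have dt: "d + t \<in> {a..b}" using t sr by auto
    have "vector_derivative (snd c \<circ> (\<lambda>t. \<gamma> (d + t))) (at t within {s..r}) =
        vector_derivative (snd c \<circ> \<gamma>) (at (d + t) within {a..b})" (is "_ = ?D")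
      if c: "c \<in> A" "\<gamma> (d + t) \<in> fst c" for c
    proof -
      have "(snd c \<circ> \<gamma> has_derivative (\<lambda>h. h *\<^sub>R ?D)) (at (d + t) within {a..b})"
        using smooth_curve_has_vector_derivative[OF A \<gamma> dt c] c
        by (simp add: velocity_def has_vector_derivative_def)
      then have *: "(snd c \<circ> \<gamma> has_derivative (\<lambda>h. h *\<^sub>R ?D)) (at (d + t) within (+) d ` {s..r})"
        by (rule has_derivative_subset) (use sr in auto)
      have "((\<lambda>t. (snd c \<circ> \<gamma>) (d + t)) has_derivative (\<lambda>h. h *\<^sub>R ?D)) (at t within {s..r})"
        by (rule has_derivative_in_compose[OF _ *]) (auto intro!: derivative_eq_intros)
      then have "(snd c \<circ> (\<lambda>t. \<gamma> (d + t)) has_vector_derivative ?D) (at t within {s..r})"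
        by (simp add: has_vector_derivative_def comp_def)
      then show ?thesis by (rule vector_derivative_within[OF at_within_Icc_neq_bot[OF sr(1) t]])
    qed
    then show ?thesis by (simp add: velocity_def fun_eq_iff del: split_paired_All)
  qed
  ultimately show ?thesis
    using cont V sr unfolding timelike_piece_def smooth_curve_def by auto
qed

lemma timelike_curve_subinterval:
  assumes "smooth_atlas A" "timelike_curve A E \<gamma> a b" "a \<le> s" "s < r" "r \<le> b"
  shows "timelike_curve A E \<gamma> s r"
  using assms(2) unfolding timelike_curve_pieces
proof (rule piecewise_subinterval[OF _ assms(3-5)])
  show "timelike_piece A E \<gamma> s' r'"
    if "timelike_piece A E \<gamma> s r" "s \<le> s'" "s' < r'" "r' \<le> r" for s r s' r'
    using timelike_piece_translate[OF assms(1) that(1,3), of 0] that by simp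
qed

lemma timelike_curve_translate:
  assumes "smooth_atlas A" "timelike_curve A E \<gamma> a b"
  shows "timelike_curve A E (\<lambda>t. \<gamma> (t - d)) (a + d) (b + d)"
  using assms(2) unfolding timelike_curve_pieces
proof (rule piecewise_translate)
  show "timelike_piece A E (\<lambda>t. \<gamma> (t - d)) (s + d) (r + d)"
    if "s < r" "timelike_piece A E \<gamma> s r" for s r
    using timelike_piece_translate[OF assms(1) that(2), of "s + d" "r + d" "- d"] that(1)
    by (simp add: algebra_simps)
qed

lemma timelike_curve_cong:
  assumes "timelike_curve A E \<gamma> a b" "\<And>t. t \<in> {a..b} \<Longrightarrow> \<gamma> t = \<gamma>' t"
  shows "timelike_curve A E \<gamma>' a b"
  using assms(1) unfolding timelike_curve_pieces
proof (rule piecewise_mono)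
  show "timelike_piece A E \<gamma>' s r" if "a \<le> s" "r \<le> b" "timelike_piece A E \<gamma> s r" for s r
    by (rule timelike_piece_cong[OF _ that(3)]) (use assms(2) that in auto)
qed

lemma timelike_curve_continuous: "timelike_curve A E \<gamma> a b \<Longrightarrow> continuous_on {a..b} \<gamma>"
  unfolding timelike_curve_pieces
proof (induction rule: piecewise_induct)
  case (step b c)
  have "continuous_on ({a..b} \<union> {b..c}) \<gamma>"
    using step by (intro continuous_on_closed_Un) (auto simp: timelike_piece_def smooth_curve_def)
  then show ?case using piecewise_le[OF step.hyps(1)] step.hyps(2) ivl_disj_un_two_touch(4) by (metis less_imp_le)
qed simp

text \<open>Turns the information that the curve stays in \<open>K\<close> into one about its
  velocities, which is the form that \<open>chart_displacement\<close> takes.\<close>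

lemma timelike_curve_restrict:
  assumes "timelike_curve A E \<gamma> a b" "\<And>t. t \<in> {a..b} \<Longrightarrow> \<gamma> t \<in> K"
  shows "timelike_curve A {v\<in>E. fst v \<in> K} \<gamma> a b"
  using assms(1) unfolding timelike_curve_pieces
  by (rule piecewise_mono) (use assms(2) in \<open>auto simp: timelike_piece_def velocity_def\<close>)

lemma timelike_curve_mono: "timelike_curve A E \<gamma> a b \<Longrightarrow> E \<subseteq> E' \<Longrightarrow> timelike_curve A E' \<gamma> a b"
  unfolding timelike_curve_pieces
  by (erule piecewise_mono) (auto simp: timelike_piece_def)

definition timelike_reach ::
    "('a::topological_space, 'e::euclidean_space) chart set \<Rightarrow> ('a, 'e) tvec set \<Rightarrow>
     'a \<Rightarrow> 'a \<Rightarrow> bool" where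
  "timelike_reach A E p q \<longleftrightarrow> (\<exists>\<gamma> a b. a < b \<and> timelike_curve A E \<gamma> a b \<and> \<gamma> a = p \<and> \<gamma> b = q)"

lemma timelike_reach_mono: "timelike_reach A E p q \<Longrightarrow> E \<subseteq> E' \<Longrightarrow> timelike_reach A E' p q"
  unfolding timelike_reach_def using timelike_curve_mono by blast

lemma timelike_reach_subcurve:
  assumes "smooth_atlas A" "timelike_curve A E \<gamma> a b" "a \<le> s" "s < r" "r \<le> b"
  shows "timelike_reach A E (\<gamma> s) (\<gamma> r)"
  using timelike_curve_subinterval[OF assms] assms(4) unfolding timelike_reach_def by blast

lemma timelike_reach_from:
  assumes "smooth_atlas A" "timelike_reach A E p q"
  obtains \<gamma> b where "a < b" "timelike_curve A E \<gamma> a b" "\<gamma> a = p" "\<gamma> b = q"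
proof -
  obtain \<gamma> a' b where "a' < b" "timelike_curve A E \<gamma> a' b" "\<gamma> a' = p" "\<gamma> b = q"
    using assms(2) unfolding timelike_reach_def by blast
  then show thesis
    using timelike_curve_translate[OF assms(1), of E \<gamma> a' b "a - a'"]
      that[of "b + (a - a')" "\<lambda>t. \<gamma> (t - (a - a'))"] by simp
qed

lemma timelike_reach_trans:
  assumes "smooth_atlas A" "timelike_reach A E p q" "timelike_reach A E q r"
  shows "timelike_reach A E p r"
proof -
  obtain \<gamma> a b where \<gamma>: "a < b" "timelike_curve A E \<gamma> a b" "\<gamma> a = p" "\<gamma> b = q"
    using assms(2) unfolding timelike_reach_def by blast
  obtain \<delta> c where \<delta>: "b < c" "timelike_curve A E \<delta> b c" "\<delta> b = q" "\<delta> c = r"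
    using timelike_reach_from[OF assms(1,3)] .
  let ?h = "\<lambda>t. if t \<le> b then \<gamma> t else \<delta> t"
  have "timelike_curve A E ?h a b" by (rule timelike_curve_cong[OF \<gamma>(2)]) simp
  moreover have "timelike_curve A E ?h b c"
    by (rule timelike_curve_cong[OF \<delta>(2)]) (use \<gamma> \<delta> in auto)
  ultimately have "timelike_curve A E ?h a c"
    unfolding timelike_curve_pieces by (rule piecewise_trans)
  then show ?thesis
    unfolding timelike_reach_def using \<gamma> \<delta> by (intro exI[of _ ?h] exI[of _ a] exI[of _ c]) auto
qed

text \<open>Distinct end points exclude both \<open>T = 0\<close> and constant curves; for equal
  ones a constant curve would count on the right only.\<close>

lemma chron_future_iff:
  assumes "smooth_atlas A" "p \<noteq> q"
  shows "q \<in> chron_future A E p \<longleftrightarrow> timelike_reach A E p q"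
proof
  assume "q \<in> chron_future A E p"
  then obtain \<gamma> T where "timelike_curve A E \<gamma> 0 T" "\<gamma> 0 = p" "\<gamma> T = q" "0 \<le> T"
    by (auto simp: chron_future_def)
  moreover from this assms(2) have "0 < T" by (metis order_less_le)
  ultimately show "timelike_reach A E p q" unfolding timelike_reach_def by blast
next
  assume "timelike_reach A E p q"
  then obtain \<gamma> T where "0 < T" "timelike_curve A E \<gamma> 0 T" "\<gamma> 0 = p" "\<gamma> T = q"
    by (rule timelike_reach_from[OF assms(1)])
  moreover from this have "\<exists>s\<in>{0..T}. \<exists>t\<in>{0..T}. \<gamma> s \<noteq> \<gamma> t"
    using assms(2) by (intro bexI[of _ 0] bexI[of _ T]) auto
  ultimately show "q \<in> chron_future A E p" unfolding chron_future_def by blast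
qed

section \<open>Straight segments in a chart\<close>

lemma tangent_overI: "v \<in> tangent_space A x \<Longrightarrow> x \<in> fst c \<Longrightarrow> v \<in> tangent_over A c"
  by (auto simp: tangent_over_def tangent_bundle_def tangent_space_def)

definition chart_segment :: "('a, 'e::euclidean_space) chart \<Rightarrow> 'e \<Rightarrow> 'e \<Rightarrow> real \<Rightarrow> 'a" where
  "chart_segment c p d t = inv_into (fst c) (snd c) (p + t *\<^sub>R d)"

text \<open>In another chart the segment is a transition map composed with an affine map, and
  transition maps are smooth.\<close>

lemma smooth_curve_chart_segment:
  assumes A: "smooth_atlas A" and c: "c \<in> A" and b: "0 < b"
    and dom: "\<And>t. t \<in> {0..b} \<Longrightarrow> p + t *\<^sub>R d \<in> snd c ` fst c"
  shows "smooth_curve A (chart_segment c p d) 0 b"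
proof -
  let ?\<sigma> = "chart_segment c p d"
  have cont: "continuous_on {0..b} ?\<sigma>"
    unfolding chart_segment_def
    by (rule continuous_on_compose2[OF chartD(5)[OF A c]]) (use dom in \<open>auto intro!: continuous_intros\<close>)
  have \<sigma>: "?\<sigma> t \<in> fst c" "snd c (?\<sigma> t) = p + t *\<^sub>R d" if "t \<in> {0..b}" for t
    using dom[OF that] by (simp_all add: chart_segment_def inv_into_into f_inv_into_f)
  have "smooth_on {t\<in>{0..b}. ?\<sigma> t \<in> fst c'} (\<lambda>t. transition c c' (p + t *\<^sub>R d))" if c': "c' \<in> A" for c'
  proof (rule smooth_on_compose_affine[OF transition_smooth[OF A c c']])
    show "at t within {t \<in> {0..b}. ?\<sigma> t \<in> fst c'} \<noteq> bot"
      if "t \<in> {t \<in> {0..b}. ?\<sigma> t \<in> fst c'}" for t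
      using at_within_Collect_open_neq_bot[OF cont chartD(1)[OF A c'] b that] .
    show "p + t *\<^sub>R d \<in> snd c ` (fst c \<inter> fst c')" if "t \<in> {t \<in> {0..b}. ?\<sigma> t \<in> fst c'}" for t
    proof -
      have "snd c (?\<sigma> t) \<in> snd c ` (fst c \<inter> fst c')" using that \<sigma>(1) by (intro imageI) auto
      then show ?thesis using \<sigma>(2) that by simp
    qed
  qed
  then show ?thesis
    using cont by (simp add: smooth_curve_def transition_def chart_segment_def comp_def)
qed

lemma velocity_chart_segment:
  assumes A: "smooth_atlas A" and c: "c \<in> A" and b: "0 < b"
    and dom: "\<And>t. t \<in> {0..b} \<Longrightarrow> p + t *\<^sub>R d \<in> snd c ` fst c" and t: "t \<in> {0..b}"
  shows "velocity A (chart_segment c p d) {0..b} t \<in> tangent_over A c"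
    "tcoords c (velocity A (chart_segment c p d) {0..b} t) = (p + t *\<^sub>R d, d)"
proof -
  let ?\<sigma> = "chart_segment c p d"
  let ?v = "velocity A ?\<sigma> {0..b} t"
  have \<sigma>: "?\<sigma> t \<in> fst c" "snd c (?\<sigma> t) = p + t *\<^sub>R d" if "t \<in> {0..b}" for t
    using dom[OF that] by (simp_all add: chart_segment_def inv_into_into f_inv_into_f)
  have "?v \<in> tangent_space A (?\<sigma> t)"
    using velocity_in_tangent_space[OF A smooth_curve_chart_segment[OF A c b dom] b t] .
  then show "?v \<in> tangent_over A c" by (rule tangent_overI) (rule \<sigma>(1)[OF t])
  have "((\<lambda>s. p + s *\<^sub>R d) has_vector_derivative d) (at t within {0..b})"
    by (auto intro!: derivative_eq_intros)
  then have "(snd c \<circ> ?\<sigma> has_vector_derivative d) (at t within {0..b})"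
    unfolding has_vector_derivative_def
    by (rule has_derivative_transform[rotated 2]) (use t \<sigma> in auto)
  then have "vector_derivative (snd c \<circ> ?\<sigma>) (at t within {0..b}) = d"
    by (rule vector_derivative_within[OF at_within_Icc_neq_bot[OF b t]])
  then show "tcoords c ?v = (p + t *\<^sub>R d, d)"
    using c \<sigma>[OF t] by (simp add: tcoords_def velocity_def)
qed

text \<open>A tangent vector is a compatible family over all charts. Instead of checking the cocycle
  rule for derivatives of transition maps, the family is obtained as the initial velocity of a short
  segment in direction \<open>u\<close>.\<close>

lemma tcoords_surj:
  assumes A: "smooth_atlas A" and c: "c \<in> A" and p: "p \<in> snd c ` fst c"
  obtains v where "v \<in> tangent_over A c" "tcoords c v = (p, u)"
proof -
  obtain e where e: "e > 0" "cball p e \<subseteq> snd c ` fst c"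
    using chartD(2)[OF A c] p open_contains_cball by blast
  \<comment> \<open>Keeps the segment inside the ball of radius \<open>e\<close>; the summand 1
    covers \<open>u = 0\<close>.\<close>
  define b where "b = e / (norm u + 1)"
  have b: "b > 0" using e by (simp add: b_def add_nonneg_pos)
  have "p + t *\<^sub>R u \<in> snd c ` fst c" if t: "t \<in> {0..b}" for t
  proof -
    have "norm (t *\<^sub>R u) \<le> b * (norm u + 1)" using t by (auto intro: mult_mono)
    also have "\<dots> = e" using add_nonneg_pos[OF norm_ge_zero[of u] zero_less_one] by (simp add: b_def)
    finally show ?thesis using e(2) by (auto simp: dist_norm)
  qed
  from velocity_chart_segment[OF A c b this, of 0] b that show thesis by simp
qed

text \<open>The coordinate velocity of the segment is constant, so a single direction is tested at
  all points of a convex set containing the segment. The case \<open>p = q\<close> is included and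
  gives a constant curve.\<close>

lemma timelike_reach_chart_segment:
  assumes A: "smooth_atlas A" and c: "c \<in> A" and S: "convex S" "S \<subseteq> snd c ` fst c"
    and pq: "snd c p \<in> S" "snd c q \<in> S" "p \<in> fst c" "q \<in> fst c"
    and E: "\<And>z. z \<in> S \<Longrightarrow> (z, snd c q - snd c p) \<in> tcoords c ` (E \<inter> tangent_over A c)"
  shows "timelike_reach A E p q"
proof -
  let ?p = "snd c p" and ?d = "snd c q - snd c p"
  have S': "?p + t *\<^sub>R ?d \<in> S" if "t \<in> {0..1}" for t
    using convexD_alt[OF S(1) pq(1,2), of t] that by (simp add: algebra_simps)
  then have dom: "?p + t *\<^sub>R ?d \<in> snd c ` fst c" if "t \<in> {0..1}" for t
    using S(2) that by blast
  note vel = velocity_chart_segment[OF A c zero_less_one dom]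
  have "velocity A (chart_segment c ?p ?d) {0..1} t \<in> E" if t: "t \<in> {0..1}" for t
  proof -
    obtain v where "v \<in> E" "v \<in> tangent_over A c" "tcoords c v = (?p + t *\<^sub>R ?d, ?d)"
      using E[OF S'[OF t]] by force
    with vel[OF _ t] inj_onD[OF inj_on_tcoords[OF A c]] show ?thesis by metis
  qed
  then have "timelike_piece A E (chart_segment c ?p ?d) 0 1"
    using smooth_curve_chart_segment[OF A c zero_less_one dom] by (simp add: timelike_piece_def)
  then have "timelike_curve A E (chart_segment c ?p ?d) 0 1"
    by (simp add: timelike_curve_pieces piecewise_single)
  then show ?thesis
    unfolding timelike_reach_def chart_segment_def using pq(3,4) chartD(3)[OF A c]
    by (intro exI[of _ "chart_segment c ?p ?d"] exI[of _ 0] exI[of _ 1])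
      (auto simp: chart_segment_def[abs_def] inv_into_f_f)
qed

section \<open>Coordinates of cone fields\<close>

lemma tangent_space_fst: "v \<in> tangent_space A x \<Longrightarrow> fst v = x"
  by (simp only: tangent_space_def mem_Collect_eq case_prod_unfold)

lemma tangent_overD:
  assumes "v \<in> tangent_over A c"
  shows "v \<in> tangent_bundle A" "fst v \<in> fst c" "v \<in> tangent_space A (fst v)"
  using assms by (auto simp: tangent_over_def tangent_bundle_def dest: tangent_space_fst)

lemma tcoords_transition:
  assumes "smooth_atlas A" "c \<in> A" "c' \<in> A" "v \<in> tangent_over A c" "v \<in> tangent_over A c'"
  shows "tcoords c' v = (transition c c' (fst (tcoords c v)),
    frechet_derivative (transition c c') (at (fst (tcoords c v))) (snd (tcoords c v)))"
proof -
  obtain x w where v: "v = (x, w)" by force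
  have "(x, w) \<in> tangent_space A x" "x \<in> fst c" "x \<in> fst c'"
    using tangent_overD(3)[OF assms(4)] tangent_overD(2)[OF assms(4)] tangent_overD(2)[OF assms(5)]
    by (simp_all add: v)
  then have "w c' = frechet_derivative (transition c c') (at (snd c x)) (w c)"
    using assms(2,3) unfolding tangent_space_def by blast
  then show ?thesis
    using transition_apply[OF assms(1,2) \<open>x \<in> fst c\<close>] by (simp add: v tcoords_def)
qed

text \<open>The topology tests openness in every chart, but coordinate changes of the tangent bundle
  are continuous, so one chart is enough for a set lying over its domain.\<close>

lemma openin_tangent_overI:
  assumes A: "smooth_atlas A" and c: "c \<in> A" and W: "W \<subseteq> tangent_over A c"
    and o: "open (tcoords c ` W)"
  shows "openin (tangent_topology A) W"
proof -
  have "open (tcoords c' ` (W \<inter> tangent_over A c'))" if c': "c' \<in> A" for c'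
  proof -
    let ?S = "snd c' ` (fst c' \<inter> fst c)"
    let ?D = "\<lambda>p. frechet_derivative (transition c' c) (at p)"
    let ?\<Phi> = "\<lambda>q. (transition c' c (fst q), ?D (fst q) (snd q))"
    have S: "open ?S" using open_chart_image[OF A c'] chartD(1)[OF A c] by blast
    have D: "(transition c' c has_derivative ?D p) (at p)" if "p \<in> ?S" for p
      using transition_has_derivative[OF A c' c] that by auto
    have "continuous_on ?S (transition c' c)"
      by (rule continuous_at_imp_continuous_on) (use D has_derivative_continuous in blast)
    moreover have "continuous_on (?S \<times> UNIV) (\<lambda>q. ?D (fst q) (snd q))"
    proof -
      \<comment> \<open>Known is only the continuity of the derivative in each fixed direction;
        expanding the vector in the basis gives joint continuity.\<close>
      have "continuous_on (?S \<times> UNIV) (\<lambda>q. \<Sum>b\<in>Basis. (snd q \<bullet> b) *\<^sub>R ?D (fst q) b)"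
      proof (intro continuous_intros)
        show "continuous_on (?S \<times> UNIV) (\<lambda>q. ?D (fst q) b)" for b
          by (rule continuous_on_compose2[OF transition_continuous_derivative[OF A c' c]])
            (auto intro!: continuous_intros)
      qed
      moreover have "(\<Sum>b\<in>Basis. (snd q \<bullet> b) *\<^sub>R ?D (fst q) b) = ?D (fst q) (snd q)"
        if q: "q \<in> ?S \<times> UNIV" for q
      proof -
        have lin: "linear (?D (fst q))" using q D[THEN has_derivative_linear] by (simp add: mem_Times_iff)
        have "?D (fst q) (snd q) = ?D (fst q) (\<Sum>b\<in>Basis. (snd q \<bullet> b) *\<^sub>R b)"
          by (simp only: euclidean_representation)
        then show ?thesis by (simp add: linear_sum[OF lin] linear_scale[OF lin])
      qed
      ultimately show ?thesis by (rule continuous_on_eq)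
    qed
    ultimately have "continuous_on (?S \<times> UNIV) ?\<Phi>"
      by (intro continuous_on_Pair continuous_on_compose2[of ?S "transition c' c" _ fst])
        (auto intro!: continuous_intros)
    from continuous_open_preimage[OF this open_Times[OF S open_UNIV] o]
    have "open (?S \<times> UNIV \<inter> ?\<Phi> -` (tcoords c ` W))" .
    moreover have "tcoords c' ` (W \<inter> tangent_over A c') = ?S \<times> UNIV \<inter> ?\<Phi> -` (tcoords c ` W)"
    proof (intro subset_antisym subsetI)
      fix q assume "q \<in> tcoords c' ` (W \<inter> tangent_over A c')"
      then obtain v where v: "v \<in> W" "v \<in> tangent_over A c'" "q = tcoords c' v" by blast
      then have "?\<Phi> q = tcoords c v" using tcoords_transition[OF A c' c, of v] W by auto
      moreover have "fst q \<in> ?S" using v W by (auto simp: tcoords_def tangent_over_def)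
      ultimately show "q \<in> ?S \<times> UNIV \<inter> ?\<Phi> -` (tcoords c ` W)"
        using v(1) by (auto simp: mem_Times_iff)
    next
      fix q assume q: "q \<in> ?S \<times> UNIV \<inter> ?\<Phi> -` (tcoords c ` W)"
      then obtain x where x: "x \<in> fst c'" "x \<in> fst c" "fst q = snd c' x" by auto
      then obtain v where v: "v \<in> tangent_over A c'" "tcoords c' v = (fst q, snd q)"
        using tcoords_surj[OF A c'] by (metis imageI)
      then have "fst v = x"
        using x tangent_overD(2)[OF v(1)] inj_onD[OF chartD(3)[OF A c']]
        by (simp add: tcoords_def)
      then have vc: "v \<in> tangent_over A c" using v(1) x(2) by (auto simp: tangent_over_def)
      then have "?\<Phi> q = tcoords c v" using tcoords_transition[OF A c' c v(1)] v(2) by simp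
      then obtain w where "w \<in> W" "tcoords c v = tcoords c w" using q by auto
      then have "v \<in> W" using inj_onD[OF inj_on_tcoords[OF A c]] vc W by blast
      then show "q \<in> tcoords c' ` (W \<inter> tangent_over A c')"
        using v by (metis IntI image_eqI prod.collapse)
    qed
    ultimately show ?thesis by simp
  qed
  moreover have "W \<subseteq> tangent_bundle A" using W tangent_overD(1) by blast
  ultimately show ?thesis unfolding openin_tangent_topology[OF A] by blast
qed

lemma tcoords_image_Int:
  "tcoords c ` (X \<inter> tangent_over A c \<inter> {v. tcoords c v \<in> Y}) = tcoords c ` (X \<inter> tangent_over A c) \<inter> Y"
  by auto

lemma openin_tangent_restrict_base:
  assumes A: "smooth_atlas A" and E: "openin (tangent_topology A) E" and U: "open U"
  shows "openin (tangent_topology A) {v\<in>E. fst v \<in> U}"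
proof -
  have "open (tcoords c ` ({v\<in>E. fst v \<in> U} \<inter> tangent_over A c))" if c: "c \<in> A" for c
  proof -
    have "{v\<in>E. fst v \<in> U} \<inter> tangent_over A c =
        E \<inter> tangent_over A c \<inter> {v. tcoords c v \<in> snd c ` (fst c \<inter> U) \<times> UNIV}"
      using inj_onD[OF chartD(3)[OF A c]] by (fastforce simp: tcoords_def tangent_over_def)
    then have eq: "tcoords c ` ({v\<in>E. fst v \<in> U} \<inter> tangent_over A c) =
        tcoords c ` (E \<inter> tangent_over A c) \<inter> snd c ` (fst c \<inter> U) \<times> UNIV"
      by (simp only: tcoords_image_Int)
    have "open (tcoords c ` (E \<inter> tangent_over A c))"
      using E c unfolding openin_tangent_topology[OF A] by blast
    then show ?thesis
      unfolding eq by (rule open_Int[OF _ open_Times[OF open_chart_image[OF A c U] open_UNIV]])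
  qed
  then show ?thesis using E unfolding openin_tangent_topology[OF A] by blast
qed

text \<open>Used to read closedness of \<open>C \<union> zero_section\<close> as openness of its
  complement within the bundle.\<close>

lemma topspace_tangent_topology:
  assumes A: "smooth_atlas A"
  shows "topspace (tangent_topology A) = tangent_bundle A"
proof -
  have "open (tcoords c ` (tangent_bundle A \<inter> tangent_over A c))" if c: "c \<in> A" for c
  proof -
    have "tcoords c ` (tangent_bundle A \<inter> tangent_over A c) = (snd c ` fst c) \<times> UNIV"
    proof (intro subset_antisym subsetI)
      fix q assume q: "q \<in> (snd c ` fst c) \<times> (UNIV :: 'b set)"
      then obtain v where "v \<in> tangent_over A c" "tcoords c v = (fst q, snd q)"
        using tcoords_surj[OF A c] by (metis mem_Times_iff)
      then show "q \<in> tcoords c ` (tangent_bundle A \<inter> tangent_over A c)"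
        using tangent_overD(1) by (metis IntI image_eqI prod.collapse)
    qed (auto simp: tcoords_def tangent_over_def)
    then show ?thesis using chartD(2)[OF A c] open_Times by (metis open_UNIV)
  qed
  then have "openin (tangent_topology A) (tangent_bundle A)"
    unfolding openin_tangent_topology[OF A] by blast
  moreover have "topspace (tangent_topology A) \<subseteq> tangent_bundle A"
    using openin_topspace[of "tangent_topology A"] unfolding openin_tangent_topology[OF A] by blast
  ultimately show ?thesis using openin_subset by blast
qed

text \<open>Bridges the two ways in which a cone field is constrained: cones are tested on fibres,
  openness on coordinate images.\<close>

lemma fibre_coords_iff:
  assumes A: "smooth_atlas A" and c: "c \<in> A" and x: "x \<in> fst c"
  shows "u \<in> fibre_coords A c x X \<longleftrightarrow> (snd c x, u) \<in> tcoords c ` (X \<inter> tangent_over A c)"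
proof
  assume "u \<in> fibre_coords A c x X"
  then obtain v where v: "v \<in> X" "v \<in> tangent_space A x" "u = snd v c"
    by (auto simp: fibre_coords_def)
  moreover have "fst v = x" using tangent_space_fst[OF v(2)] .
  ultimately show "(snd c x, u) \<in> tcoords c ` (X \<inter> tangent_over A c)"
    using tangent_overI[OF v(2) x] by (auto simp: tcoords_def intro!: image_eqI[of _ _ v])
next
  assume "(snd c x, u) \<in> tcoords c ` (X \<inter> tangent_over A c)"
  then obtain v where v: "v \<in> X" "v \<in> tangent_over A c" "snd c (fst v) = snd c x" "snd v c = u"
    by (auto simp: tcoords_def)
  then have "fst v = x" using tangent_overD(2) x inj_onD[OF chartD(3)[OF A c]] by metis
  then show "u \<in> fibre_coords A c x X"
    using v tangent_overD(3)[OF v(2)] by (auto simp: fibre_coords_def)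
qed

lemma cvx_cone_linear_image: "linear f \<Longrightarrow> cvx_cone K \<Longrightarrow> cvx_cone (f ` K)"
  unfolding cvx_cone_def by (auto simp: convex_linear_image linear_scale[symmetric])

lemma cvx_cone_Int: "cvx_cone K \<Longrightarrow> cvx_cone L \<Longrightarrow> cvx_cone (K \<inter> L)"
  unfolding cvx_cone_def by (auto simp: convex_Int)

text \<open>The change of coordinates in a fibre is linear, so the condition may be tested in
  whichever chart is convenient.\<close>

lemma cvx_cone_fibre_coords:
  assumes A: "smooth_atlas A" and c: "c \<in> A" "c' \<in> A" and x: "x \<in> fst c" "x \<in> fst c'"
    and K: "cvx_cone (fibre_coords A c x X)"
  shows "cvx_cone (fibre_coords A c' x X)"
proof -
  let ?D = "frechet_derivative (transition c c') (at (snd c x))"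
  have "snd v c' = ?D (snd v c)" if v: "v \<in> tangent_space A x" for v
    using v c x unfolding tangent_space_def mem_Collect_eq case_prod_unfold by blast
  then have "fibre_coords A c' x X = ?D ` fibre_coords A c x X"
    unfolding fibre_coords_def image_image by (intro image_cong) auto
  then show ?thesis
    using cvx_cone_linear_image[OF has_derivative_linear K] transition_has_derivative[OF A c x]
    by metis
qed

text \<open>Vectors are discarded only over the closed set \<open>N\<close>. The result is a union
  of two open sets: the part of \<open>E\<close> off \<open>N\<close>, and the part of
  \<open>E\<close> over the chart domain with vector coordinates in \<Omega>, which off
  \<open>N\<close> adds nothing new.\<close>

lemma open_cone_field_restrict:
  assumes A: "smooth_atlas A" and E: "open_cone_field A E" and c: "c \<in> A"
    and N: "closed N" "N \<subseteq> fst c" and \<Omega>: "open \<Omega>" "cvx_cone \<Omega>"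
  shows "open_cone_field A {v\<in>E. fst v \<in> N \<longrightarrow> snd v c \<in> \<Omega>}" (is "open_cone_field A ?F")
proof -
  have Eo: "openin (tangent_topology A) E"
    and Ec: "\<And>c x. c \<in> A \<Longrightarrow> x \<in> fst c \<Longrightarrow> cvx_cone (fibre_coords A c x E)"
    and Eb: "E \<subseteq> tangent_bundle A"
    using E by (auto simp: open_cone_field_def cone_field_def)
  let ?W = "E \<inter> tangent_over A c \<inter> {v. tcoords c v \<in> UNIV \<times> \<Omega>}"
  have "open (tcoords c ` ?W)"
    unfolding tcoords_image_Int using open_Int[OF _ open_Times[OF open_UNIV \<Omega>(1)]] Eo c
    unfolding openin_tangent_topology[OF A] by blast
  then have "openin (tangent_topology A) ?W" by (intro openin_tangent_overI[OF A c]) auto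
  moreover have "openin (tangent_topology A) {v\<in>E. fst v \<in> - N}"
    using openin_tangent_restrict_base[OF A Eo] N(1) by blast
  moreover have "{v\<in>E. fst v \<in> - N} \<union> ?W = ?F"
  proof (intro subset_antisym subsetI)
    fix v assume "v \<in> ?F"
    then show "v \<in> {v\<in>E. fst v \<in> - N} \<union> ?W"
      using Eb N(2) by (cases "fst v \<in> N") (auto simp: tcoords_def tangent_over_def)
  qed (auto simp: tcoords_def)
  ultimately have F: "openin (tangent_topology A) ?F" using openin_Un by fastforce
  moreover have "cvx_cone (fibre_coords A c' x ?F)" if c': "c' \<in> A" "x \<in> fst c'" for c' x
  proof (cases "x \<in> N")
    case True
    then have x: "x \<in> fst c" using N by blast
    have "fibre_coords A c x ?F = fibre_coords A c x E \<inter> \<Omega>"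
      using True by (auto simp: fibre_coords_def dest: tangent_space_fst)
    then have "cvx_cone (fibre_coords A c x ?F)" using cvx_cone_Int Ec[OF c x] \<Omega>(2) by metis
    then show ?thesis using cvx_cone_fibre_coords[OF A c c'(1) x c'(2)] by blast
  next
    case False
    then have "fibre_coords A c' x ?F = fibre_coords A c' x E"
      by (auto simp: fibre_coords_def dest: tangent_space_fst)
    then show ?thesis using Ec[OF c'] by simp
  qed
  ultimately show ?thesis using Eb F by (auto simp: open_cone_field_def cone_field_def)
qed

section \<open>Convex cones and neighbourhoods of their slices\<close>

lemma cvx_coneI:
  assumes "\<And>x y. x \<in> K \<Longrightarrow> y \<in> K \<Longrightarrow> x + y \<in> K" "\<And>t x. t > 0 \<Longrightarrow> x \<in> K \<Longrightarrow> t *\<^sub>R x \<in> K"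
  shows "cvx_cone K"
  unfolding cvx_cone_def
proof (intro conjI convexI allI impI ballI)
  fix x y and u v :: real
  assume "x \<in> K" "y \<in> K" "0 \<le> u" "0 \<le> v" "u + v = 1"
  then show "u *\<^sub>R x + v *\<^sub>R y \<in> K"
    using assms by (cases "u = 0"; cases "v = 0") auto
qed (use assms in auto)

lemma cvx_cone_add: "cvx_cone K \<Longrightarrow> x \<in> K \<Longrightarrow> y \<in> K \<Longrightarrow> x + y \<in> K"
proof -
  assume K: "cvx_cone K" and xy: "x \<in> K" "y \<in> K"
  have "(1/2) *\<^sub>R x + (1/2) *\<^sub>R y \<in> K"
    using K xy by (intro convexD) (auto simp: cvx_cone_def)
  then have "2 *\<^sub>R ((1/2) *\<^sub>R x + (1/2) *\<^sub>R y) \<in> K" using K unfolding cvx_cone_def by (metis zero_less_numeral)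
  then show ?thesis by (simp add: scaleR_add_right)
qed

lemma cvx_cone_scaled_image:
  assumes "convex P"
  shows "cvx_cone {t *\<^sub>R x |t x. t > 0 \<and> x \<in> P}"
proof (rule cvx_coneI)
  fix x y assume "x \<in> {t *\<^sub>R x |t x. t > 0 \<and> x \<in> P}" "y \<in> {t *\<^sub>R x |t x. t > 0 \<and> x \<in> P}"
  then obtain s a t b where *: "x = s *\<^sub>R a" "y = t *\<^sub>R b" "s > 0" "t > 0" "a \<in> P" "b \<in> P" by blast
  define z where "z = (s / (s + t)) *\<^sub>R a + (t / (s + t)) *\<^sub>R b"
  have "z \<in> P"
    unfolding z_def using assms * by (intro convexD) (auto simp: add_divide_distrib[symmetric])
  moreover have "x + y = (s + t) *\<^sub>R z"
    using * by (simp add: z_def scaleR_add_right)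
  ultimately show "x + y \<in> {t *\<^sub>R x |t x. t > 0 \<and> x \<in> P}" using *(3,4) by (blast intro: add_pos_pos)
next
  fix r :: real and x assume "r > 0" "x \<in> {t *\<^sub>R x |t x. t > 0 \<and> x \<in> P}"
  then obtain t a where "x = t *\<^sub>R a" "t > 0" "a \<in> P" by blast
  then have "r *\<^sub>R x = (r * t) *\<^sub>R a" "r * t > 0" "a \<in> P" using \<open>r > 0\<close> by auto
  then show "r *\<^sub>R x \<in> {t *\<^sub>R x |t x. t > 0 \<and> x \<in> P}" by blast
qed

text \<open>On the unit vectors of \<open>K\<close>, which form a compact set, the positive form
  \<open>p\<close> is at least some \<open>m > 0\<close>; by scaling, the slice at height 1 is
  bounded by \<open>1 / m\<close>.\<close>

lemma closed_cone_slice: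
  fixes K :: "'e::euclidean_space set"
  assumes "closed_cone K" "K \<noteq> UNIV"
  obtains p :: "'e \<Rightarrow> real" where "linear p" "\<And>k. k \<in> K \<Longrightarrow> p k > 0" "compact {k\<in>K. p k = 1}"
proof (cases "K = {}")
  case True
  then show thesis using that[of "\<lambda>_. 0"] by (simp add: linear_conv_bounded_linear)
next
  case False
  then have K: "cvx_cone K" "closed (K \<union> {0})" and "\<exists>p :: 'e \<Rightarrow> real. linear p \<and> (\<forall>v\<in>K. p v > 0)"
    using assms by (auto simp: closed_cone_def regular_cone_def)
  then obtain p :: "'e \<Rightarrow> real" where p: "linear p" "\<And>v. v \<in> K \<Longrightarrow> p v > 0" by blast
  have cont: "continuous_on S p" for S using p(1) linear_continuous_on linear_linear by blast
  have "compact ((K \<union> {0}) \<inter> sphere 0 1)" using K(2) closed_Int_compact compact_sphere by blast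
  then obtain m where m: "m > 0" "\<And>k. k \<in> (K \<union> {0}) \<inter> sphere 0 1 \<Longrightarrow> m \<le> p k"
  proof (cases "(K \<union> {0}) \<inter> sphere 0 1 = {}")
    case False
    with continuous_attains_inf[OF \<open>compact _\<close> False cont] obtain k
      where "k \<in> (K \<union> {0}) \<inter> sphere 0 1" "\<And>l. l \<in> (K \<union> {0}) \<inter> sphere 0 1 \<Longrightarrow> p k \<le> p l" by blast
    then show ?thesis using that[of "p k"] p(2) by auto
  qed (use that[of 1] in auto)
  have "norm k \<le> 1 / m" if k: "k \<in> K" "p k = 1" for k
  proof -
    have "k \<noteq> 0" using k linear_0[OF p(1)] by auto
    then have "(1 / norm k) *\<^sub>R k \<in> (K \<union> {0}) \<inter> sphere 0 1"
      using K(1) k(1) by (simp add: cvx_cone_def)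
    from m(2)[OF this] have "m \<le> 1 / norm k" using linear_scale[OF p(1)] k(2) by simp
    then show ?thesis using m(1) \<open>k \<noteq> 0\<close> by (simp add: field_simps)
  qed
  then have "bounded {k\<in>K. p k = 1}" unfolding bounded_iff by blast
  moreover have "{k\<in>K. p k = 1} = (K \<union> {0}) \<inter> p -` {1}"
    using linear_0[OF p(1)] by auto
  then have "closed {k\<in>K. p k = 1}"
    using continuous_closed_preimage[OF cont K(2), of "{1}"] by simp
  ultimately have "compact {k\<in>K. p k = 1}" using compact_eq_bounded_closed by blast
  then show thesis using p that by blast
qed

text \<open>
  In the applications \<open>W\<close> and \<open>G\<close> are the coordinate images of an open enlargement of a closed
  cone field and of the complement of that field.  The cone \<open>\<Omega>\<close> is spanned by a neighbourhood of a
  compact slice of \<open>K\<close>; the slack \<open>\<eta>\<close> permits to move the end point of a segment with direction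
  in \<open>\<Omega>\<close>.
\<close>

lemma closed_cone_neighbourhood:
  fixes K :: "'e::euclidean_space set" and W G :: "('e \<times> 'e) set"
  assumes K: "closed_cone K" "K \<noteq> UNIV"
    and W: "open W" "\<And>k. k \<in> K \<Longrightarrow> (z0, k) \<in> W"
      "\<And>z u t. t > 0 \<Longrightarrow> (z, u) \<in> W \<Longrightarrow> (z, t *\<^sub>R u) \<in> W"
    and G: "open G" "\<And>u. u \<noteq> 0 \<Longrightarrow> u \<notin> K \<Longrightarrow> (z0, u) \<in> G"
  obtains r \<Omega> \<eta> where "r > 0" "open \<Omega>" "cvx_cone \<Omega>" "0 \<notin> \<Omega>" "\<eta> > 0"
    "\<forall>z\<in>cball z0 r. \<forall>u. norm u = 1 \<longrightarrow> u \<notin> \<Omega> \<longrightarrow> (z, u) \<in> G"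
    "\<forall>z\<in>cball z0 r. \<forall>w\<in>\<Omega>. \<forall>e. norm e < \<eta> * norm w \<longrightarrow> (z, w + e) \<in> W"
proof -
  obtain p :: "'e \<Rightarrow> real" where p: "linear p" "\<And>k. k \<in> K \<Longrightarrow> p k > 0"
    and K1: "compact {k\<in>K. p k = 1}" using closed_cone_slice[OF K] by blast
  let ?K1 = "{k\<in>K. p k = 1}"
  have cone: "cvx_cone K" using K(1) by (simp add: closed_cone_def)
  obtain B where B: "B > 0" "\<And>e. \<bar>p e\<bar> \<le> B * norm e"
    using linear_bounded_pos[OF p(1)] by auto
  obtain m where m: "m > 0" "\<And>k. k \<in> ?K1 \<Longrightarrow> norm k \<le> m"
    using compact_imp_bounded[OF K1] unfolding bounded_pos by blast
  have comp: "compact ({z0} \<times> ?K1)" by (intro compact_Times K1) simp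
  have sub: "{z0} \<times> ?K1 \<subseteq> W" using W(2) by auto
  obtain \<epsilon> where \<epsilon>: "\<epsilon> > 0" "(\<Union>q\<in>{z0} \<times> ?K1. cball q \<epsilon>) \<subseteq> W"
    by (rule compact_subset_open_imp_cball_epsilon_subset[OF comp W(1) sub])
  have inW: "(z, k + e) \<in> W" if "k \<in> ?K1" "z \<in> cball z0 (\<epsilon>/2)" "norm e \<le> \<epsilon>/2" for z k e
  proof -
    have "dist (z0, k) (z, k + e) \<le> dist z0 z + norm e"
      using sqrt_sum_squares_le_sum[of "dist z0 z" "norm e"]
      by (simp add: dist_Pair_Pair dist_norm[of k])
    also have "\<dots> \<le> \<epsilon>" using that by auto
    finally have "(z, k + e) \<in> cball (z0, k) \<epsilon>" by simp
    then show ?thesis using \<epsilon>(2) that(1) by blast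
  qed
  \<comment> \<open>The bound \<epsilon>/4 leaves room for a further error of the same size within
    the \<epsilon>/2 of \<open>inW\<close>; the bound 1/B keeps \<open>p\<close> positive on
    \<open>P\<close>, and so 0 outside \<Omega>.\<close>
  define \<delta> where "\<delta> = min (\<epsilon>/4) (1/B)"
  have \<delta>: "\<delta> > 0" "\<delta> \<le> \<epsilon>/4" "B * \<delta> \<le> 1"
    using \<epsilon>(1) B(1) by (auto simp: \<delta>_def min_def field_simps)
  define P where "P = {k + e |k e. k \<in> ?K1 \<and> e \<in> ball 0 \<delta>}"
  define \<Omega> where "\<Omega> = {t *\<^sub>R x |t x. t > 0 \<and> x \<in> P}"
  have "p ((1 - u) *\<^sub>R x + u *\<^sub>R y) = 1" if "p x = 1" "p y = 1" for u x y
    using that by (simp add: linear_add[OF p(1)] linear_scale[OF p(1)])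
  then have "convex ?K1"
    using cone unfolding cvx_cone_def convex_alt by simp
  then have "convex (\<Union>k\<in>?K1. \<Union>e\<in>ball 0 \<delta>. {k + e})" by (intro convex_sums) auto
  moreover have "P = (\<Union>k\<in>?K1. \<Union>e\<in>ball 0 \<delta>. {k + e})" unfolding P_def by blast
  ultimately have "convex P" by simp
  then have \<Omega>_cone: "cvx_cone \<Omega>" unfolding \<Omega>_def by (rule cvx_cone_scaled_image)
  have "P = (\<Union>k\<in>?K1. ball k \<delta>)"
  proof (intro subset_antisym subsetI)
    fix w assume "w \<in> (\<Union>k\<in>?K1. ball k \<delta>)"
    then obtain k where "k \<in> ?K1" "w - k \<in> ball 0 \<delta>" by (auto simp: dist_norm norm_minus_commute)
    moreover have "w = k + (w - k)" by simp
    ultimately show "w \<in> P" unfolding P_def by blast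
  qed (auto simp: P_def dist_norm)
  then have "open P" by auto
  have "\<Omega> = (\<Union>t\<in>{0<..}. (*\<^sub>R) t ` P)" by (auto simp: \<Omega>_def)
  then have \<Omega>_open: "open \<Omega>" using \<open>open P\<close> by (auto intro!: open_scaling)
  have "p x > 0" if x: "x \<in> P" for x
  proof -
    obtain k e where *: "x = k + e" "p k = 1" "norm e < \<delta>" using x by (auto simp: P_def)
    have "B * norm e < B * \<delta>" using B(1) *(3) by simp
    then have "\<bar>p e\<bar> < 1" using B(2)[of e] \<delta>(3) by linarith
    then show ?thesis using * by (simp add: linear_add[OF p(1)])
  qed
  then have "p x > 0" if "x \<in> \<Omega>" for x
    using that by (auto simp: \<Omega>_def linear_scale[OF p(1)])
  then have \<Omega>_0: "0 \<notin> \<Omega>" using linear_0[OF p(1)] by force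
  have K\<Omega>: "k \<in> \<Omega>" if "k \<in> K" for k
  proof -
    have "(1 / p k) *\<^sub>R k \<in> ?K1"
      using that p(2)[OF that] cone by (simp add: cvx_cone_def linear_scale[OF p(1)])
    then have "(1 / p k) *\<^sub>R k + 0 \<in> P" unfolding P_def using \<delta>(1) centre_in_ball by blast
    moreover have "k = p k *\<^sub>R ((1 / p k) *\<^sub>R k + 0)" using p(2)[OF that] by simp
    ultimately show ?thesis unfolding \<Omega>_def using p(2)[OF that] by blast
  qed
  \<comment> \<open>Unit vectors outside \<Omega> are nonzero and outside \<open>K\<close>, so over
    \<open>z0\<close> they lie in \<open>G\<close>; compactness extends this to all base points near
    \<open>z0\<close>.\<close>
  have comp': "compact ({z0} \<times> (sphere 0 1 - \<Omega>))"
    using \<Omega>_open by (intro compact_Times compact_diff) auto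
  have sub': "{z0} \<times> (sphere 0 1 - \<Omega>) \<subseteq> G"
  proof clarify
    fix u :: 'e assume "u \<in> sphere 0 1" "u \<notin> \<Omega>"
    then show "(z0, u) \<in> G" using K\<Omega> by (intro G(2)) auto
  qed
  obtain \<epsilon>' where \<epsilon>': "\<epsilon>' > 0" "(\<Union>q\<in>{z0} \<times> (sphere 0 1 - \<Omega>). cball q \<epsilon>') \<subseteq> G"
    by (rule compact_subset_open_imp_cball_epsilon_subset[OF comp' G(1) sub'])
  define r where "r = min (\<epsilon>/2) \<epsilon>'"
  \<comment> \<open>Elements of \<open>P\<close> have norm at most \<open>m + \<delta>\<close>. So
    an error of relative size below \<eta>, scaled back to \<open>P\<close>, is at most
    \<epsilon>/4.\<close>
  define \<eta> where "\<eta> = \<epsilon> / (4 * (m + \<delta>))"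
  show thesis
  proof (rule that[of r \<Omega> \<eta>])
    show "r > 0" "\<eta> > 0" using \<epsilon>(1) \<epsilon>'(1) m(1) \<delta>(1) by (auto simp: r_def \<eta>_def)
    show "\<forall>z\<in>cball z0 r. \<forall>u. norm u = 1 \<longrightarrow> u \<notin> \<Omega> \<longrightarrow> (z, u) \<in> G"
    proof (intro ballI allI impI)
      fix z u assume zu: "z \<in> cball z0 r" "norm (u :: 'e) = 1" "u \<notin> \<Omega>"
      have "(z, u) \<in> cball (z0, u) \<epsilon>'" using zu(1) by (simp add: dist_Pair_Pair r_def)
      moreover have "(z0, u) \<in> {z0} \<times> (sphere 0 1 - \<Omega>)" using zu by auto
      ultimately show "(z, u) \<in> G" using \<epsilon>'(2) by blast
    qed
    show "\<forall>z\<in>cball z0 r. \<forall>w\<in>\<Omega>. \<forall>e. norm e < \<eta> * norm w \<longrightarrow> (z, w + e) \<in> W"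
    proof (intro ballI allI impI)
      fix z w and e :: 'e assume z: "z \<in> cball z0 r" and w: "w \<in> \<Omega>" and e: "norm e < \<eta> * norm w"
      obtain t k e' where *: "w = t *\<^sub>R (k + e')" "t > 0" "k \<in> ?K1" "norm e' < \<delta>"
        using w by (auto simp: \<Omega>_def P_def)
      have "norm (k + e') \<le> m + \<delta>" using m(2)[OF *(3)] *(4) norm_triangle_ineq[of k e'] by linarith
      then have "\<eta> * norm w \<le> \<eta> * (t * (m + \<delta>))"
        using *(1,2) \<open>\<eta> > 0\<close> by (intro mult_left_mono) auto
      also have "\<dots> = t * (\<epsilon>/4)" using m(1) \<delta>(1) by (simp add: \<eta>_def field_simps)
      finally have "norm e \<le> t * (\<epsilon>/4)" using e by linarith
      then have "norm ((1/t) *\<^sub>R e) \<le> \<epsilon>/4" using *(2) by (simp add: field_simps)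
      then have "norm (e' + (1/t) *\<^sub>R e) \<le> \<epsilon>/2"
        using *(4) \<delta>(2) norm_triangle_ineq[of e' "(1/t) *\<^sub>R e"] by linarith
      then have "(z, k + (e' + (1/t) *\<^sub>R e)) \<in> W"
        using inW *(3) z by (simp add: r_def)
      from W(3)[OF *(2) this] show "(z, w + e) \<in> W"
        using *(1,2) by (simp add: scaleR_add_right add.assoc)
    qed
  qed (use \<Omega>_open \<Omega>_cone \<Omega>_0 in auto)
qed

section \<open>Coordinate balls, and enlargements near a non-singular point\<close>

definition chart_cball :: "('a, 'e::euclidean_space) chart \<Rightarrow> 'a \<Rightarrow> real \<Rightarrow> 'a set" where
  "chart_cball c y s = {x \<in> fst c. snd c x \<in> cball (snd c y) s}"

definition chart_ball :: "('a, 'e::euclidean_space) chart \<Rightarrow> 'a \<Rightarrow> real \<Rightarrow> 'a set" where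
  "chart_ball c y s = {x \<in> fst c. snd c x \<in> ball (snd c y) s}"

lemma compact_chart_cball:
  assumes A: "smooth_atlas A" and c: "c \<in> A" and s: "cball (snd c y) s \<subseteq> snd c ` fst c"
  shows "compact (chart_cball c y s)"
proof -
  have "chart_cball c y s = inv_into (fst c) (snd c) ` cball (snd c y) s"
  proof (intro subset_antisym subsetI)
    fix x assume "x \<in> chart_cball c y s"
    then have "x = inv_into (fst c) (snd c) (snd c x)" "snd c x \<in> cball (snd c y) s"
      using chartD(3)[OF A c] by (simp_all add: chart_cball_def)
    then show "x \<in> inv_into (fst c) (snd c) ` cball (snd c y) s" by blast
  next
    fix x assume "x \<in> inv_into (fst c) (snd c) ` cball (snd c y) s"
    then obtain p where p: "p \<in> cball (snd c y) s" "x = inv_into (fst c) (snd c) p" by blast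
    moreover from p s have "p \<in> snd c ` fst c" by blast
    ultimately show "x \<in> chart_cball c y s"
      using f_inv_into_f[of p "snd c" "fst c"] inv_into_into[of p "snd c" "fst c"]
      by (simp add: chart_cball_def)
  qed
  moreover have "continuous_on (cball (snd c y) s) (inv_into (fst c) (snd c))"
    using chartD(5)[OF A c] s continuous_on_subset by blast
  ultimately show ?thesis using compact_continuous_image compact_cball by metis
qed

lemma closed_chart_cball:
  assumes "smooth_atlas A" "c \<in> A" "cball (snd c y) s \<subseteq> snd c ` fst c"
  shows "closed (chart_cball c y s)"
  using compact_chart_cball[OF assms] compact_imp_closed by blast

lemma open_chart_ball:
  assumes "smooth_atlas A" "c \<in> A"
  shows "open (chart_ball c y s)"
proof -
  have "chart_ball c y s = fst c \<inter> snd c -` ball (snd c y) s" by (auto simp: chart_ball_def)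
  then show ?thesis
    using continuous_open_preimage[OF chartD(4,1)[OF assms] open_ball] by simp
qed

lemma singular_point_iff:
  assumes A: "smooth_atlas A" and c: "c \<in> A" and y: "y \<in> fst c"
  shows "singular_point A C y \<longleftrightarrow> fibre_coords A c y C = UNIV"
proof
  assume S: "singular_point A C y"
  have "u \<in> fibre_coords A c y C" for u
  proof -
    obtain v where v: "v \<in> tangent_over A c" "tcoords c v = (snd c y, u)"
      using tcoords_surj[OF A c] y by blast
    then have "fst v = y"
      using y tangent_overD(2)[OF v(1)] inj_onD[OF chartD(3)[OF A c]] by (simp add: tcoords_def)
    then have "v \<in> C" using S tangent_overD(3)[OF v(1)] by (auto simp: singular_point_def)
    then show ?thesis using v fibre_coords_iff[OF A c y] by (metis IntI image_eqI)
  qed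
  then show "fibre_coords A c y C = UNIV" by blast
next
  assume F: "fibre_coords A c y C = UNIV"
  have "v \<in> C" if v: "v \<in> tangent_space A y" for v
  proof -
    have "v \<in> tangent_over A c" using v y by (rule tangent_overI)
    moreover have "(snd c y, snd v c) \<in> tcoords c ` (C \<inter> tangent_over A c)"
      using fibre_coords_iff[OF A c y] F by blast
    moreover have "tcoords c v = (snd c y, snd v c)"
      using tangent_space_fst[OF v] by (simp add: tcoords_def)
    ultimately show ?thesis using inj_onD[OF inj_on_tcoords[OF A c]] by fastforce
  qed
  then show "singular_point A C y" by (auto simp: singular_point_def)
qed

text \<open>Closedness of \<open>C\<close> together with the zero section prevents the cones of
  \<open>C\<close> near \<open>y\<close> from leaving \<Omega>, so cutting \<open>E\<close> down to
  \<Omega> there still gives an enlargement. The radius \<open>s\<close> is left free so that the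
  ball can later be chosen to avoid a given point.\<close>

lemma open_enlargement_neighbourhood:
  fixes A :: "('a::{t2_space,second_countable_topology}, 'e::euclidean_space) chart set"
  assumes A: "smooth_atlas A" and C: "closed_cone_field A C" and E: "open_enlargement A C E"
    and c: "c \<in> A" and y: "y \<in> fst c" and ns: "\<not> singular_point A C y"
  obtains r \<Omega> \<eta> where "r > 0" "cball (snd c y) r \<subseteq> snd c ` fst c"
    "cvx_cone \<Omega>" "open \<Omega>" "0 \<notin> \<Omega>" "\<eta> > 0"
    "\<forall>z\<in>cball (snd c y) r. \<forall>w\<in>\<Omega>. \<forall>e. norm e < \<eta> * norm w \<longrightarrow>
       (z, w + e) \<in> tcoords c ` (E \<inter> tangent_over A c)"
    "\<forall>s\<le>r. open_enlargement A C {v\<in>E. fst v \<in> chart_cball c y s \<longrightarrow> snd v c \<in> \<Omega>}"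
proof -
  let ?W = "tcoords c ` (E \<inter> tangent_over A c)"
  let ?G = "tcoords c ` ((tangent_bundle A - (C \<union> zero_section)) \<inter> tangent_over A c)"
  let ?K = "fibre_coords A c y C"
  have Eo: "openin (tangent_topology A) E" and EC: "C \<subseteq> E"
    and Ec: "\<And>c x. c \<in> A \<Longrightarrow> x \<in> fst c \<Longrightarrow> cvx_cone (fibre_coords A c x E)"
    using E by (auto simp: open_enlargement_def open_cone_field_def cone_field_def)
  have Cc: "\<And>c x. c \<in> A \<Longrightarrow> x \<in> fst c \<Longrightarrow> closed_cone (fibre_coords A c x C)"
    and Co: "openin (tangent_topology A) (tangent_bundle A - (C \<union> zero_section))"
    and Cb: "C \<subseteq> tangent_bundle A"
    using C topspace_tangent_topology[OF A] unfolding closed_cone_field_def closedin_def cone_field_def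
    by auto
  have ne: "?K \<noteq> UNIV" using ns singular_point_iff[OF A c y] by blast
  have o: "open ?W" "open ?G" using Eo Co c unfolding openin_tangent_topology[OF A] by blast+
  have WK: "(snd c y, k) \<in> ?W" if "k \<in> ?K" for k
    using that EC unfolding fibre_coords_iff[OF A c y] by blast
  have Wt: "(z, t *\<^sub>R u) \<in> ?W" if t: "t > 0" and zu: "(z, u) \<in> ?W" for z u t
  proof -
    obtain x where x: "x \<in> fst c" "z = snd c x" using zu by (auto simp: tcoords_def tangent_over_def)
    then have "u \<in> fibre_coords A c x E" using zu fibre_coords_iff[OF A c x(1)] by simp
    then have "t *\<^sub>R u \<in> fibre_coords A c x E" using Ec[OF c x(1)] t by (simp add: cvx_cone_def)
    then show ?thesis using x fibre_coords_iff[OF A c x(1)] by simp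
  qed
  have GK: "(snd c y, u) \<in> ?G" if u: "u \<noteq> 0" "u \<notin> ?K" for u
  proof -
    obtain v where v: "v \<in> tangent_over A c" "tcoords c v = (snd c y, u)"
      using tcoords_surj[OF A c] y by blast
    then have "v \<notin> C" using u(2) unfolding fibre_coords_iff[OF A c y] by (metis IntI image_eqI)
    moreover have "v \<notin> zero_section" using u(1) v(2) by (auto simp: zero_section_def tcoords_def)
    ultimately have "v \<in> (tangent_bundle A - (C \<union> zero_section)) \<inter> tangent_over A c"
      using v(1) tangent_overD(1) by blast
    then show ?thesis using v(2) by (metis image_eqI)
  qed
  obtain r \<Omega> \<eta> where r: "r > 0" and \<Omega>: "open \<Omega>" "cvx_cone \<Omega>" "0 \<notin> \<Omega>" and \<eta>: "\<eta> > 0"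
    and G: "\<forall>z\<in>cball (snd c y) r. \<forall>u. norm u = 1 \<longrightarrow> u \<notin> \<Omega> \<longrightarrow> (z, u) \<in> ?G"
    and W: "\<forall>z\<in>cball (snd c y) r. \<forall>w\<in>\<Omega>. \<forall>e. norm e < \<eta> * norm w \<longrightarrow> (z, w + e) \<in> ?W"
    by (rule closed_cone_neighbourhood[OF Cc[OF c y] ne o(1) WK Wt o(2) GK])
  obtain r' where r': "r' > 0" "cball (snd c y) r' \<subseteq> snd c ` fst c"
    using chartD(2)[OF A c] y open_contains_cball by blast
  have "snd v c \<in> \<Omega>" if v: "v \<in> C" "fst v \<in> fst c" "snd c (fst v) \<in> cball (snd c y) r" for v
  proof -
    let ?x = "fst v" and ?u = "snd v c"
    let ?L = "fibre_coords A c ?x C"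
    \<comment> \<open>A unit vector of \<open>C\<close> outside \<Omega> would have coordinates in
      \<open>?G\<close>, that is, outside \<open>C\<close>.\<close>
    have notin: "u \<in> \<Omega>" if "norm u = 1" "u \<in> ?L" for u
    proof (rule ccontr)
      assume "u \<notin> \<Omega>"
      then have "(snd c ?x, u) \<in> ?G" using G v(3) that(1) by blast
      then obtain w where w: "w \<in> tangent_over A c" "w \<notin> C" "tcoords c w = (snd c ?x, u)"
        by force
      then show False
        using that(2) inj_onD[OF inj_on_tcoords[OF A c]] unfolding fibre_coords_iff[OF A c v(2)] by fastforce
    qed
    have "v \<in> tangent_over A c" using v(1,2) Cb by (auto simp: tangent_over_def)
    then have u: "?u \<in> ?L" using v(1) unfolding fibre_coords_iff[OF A c v(2)] by (force simp: tcoords_def)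
    \<comment> \<open>At a singular point near \<open>y\<close>, opposite unit vectors would lie in
      \<Omega>, and with them their sum 0.\<close>
    have "?L \<noteq> UNIV"
    proof
      assume L: "?L = UNIV"
      obtain b :: 'e where "b \<in> Basis" using nonempty_Basis by blast
      then have "b \<in> \<Omega>" "- b \<in> \<Omega>" using notin L by auto
      then show False using cvx_cone_add[OF \<Omega>(2), of b "- b"] \<Omega>(3) by simp
    qed
    \<comment> \<open>Neither empty nor full, the cone is regular and omits 0, so \<open>?u\<close>
      can be normalised.\<close>
    then have "regular_cone ?L" using Cc[OF c v(2)] u by (auto simp: closed_cone_def)
    then have L: "cvx_cone ?L" "0 \<notin> ?L" by (auto simp: regular_cone_def linear_0 dest!: bspec[of _ _ 0])
    then have "?u \<noteq> 0" using u by auto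
    then have "(1 / norm ?u) *\<^sub>R ?u \<in> \<Omega>" using notin L(1) u by (simp add: cvx_cone_def)
    then have "norm ?u *\<^sub>R (1 / norm ?u) *\<^sub>R ?u \<in> \<Omega>"
      using \<Omega>(2) \<open>?u \<noteq> 0\<close> unfolding cvx_cone_def by (meson zero_less_norm_iff)
    then show ?thesis using \<open>?u \<noteq> 0\<close> by simp
  qed
  then have C\<Omega>: "C \<subseteq> {v\<in>E. fst v \<in> chart_cball c y s \<longrightarrow> snd v c \<in> \<Omega>}" if "s \<le> r" for s
    using EC that by (auto simp: chart_cball_def)
  show thesis
  proof (rule that[of "min r r'" \<Omega> \<eta>])
    show "\<forall>s\<le>min r r'. open_enlargement A C {v\<in>E. fst v \<in> chart_cball c y s \<longrightarrow> snd v c \<in> \<Omega>}"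
    proof (intro allI impI)
      fix s assume s: "s \<le> min r r'"
      have "cball (snd c y) s \<subseteq> snd c ` fst c" using s r'(2) subset_cball[of s r'] by auto
      then have "closed (chart_cball c y s)" using closed_chart_cball[OF A c] by blast
      then have "open_cone_field A {v\<in>E. fst v \<in> chart_cball c y s \<longrightarrow> snd v c \<in> \<Omega>}"
        using E by (intro open_cone_field_restrict[OF A _ c _ _ \<Omega>(1,2)])
          (auto simp: open_enlargement_def chart_cball_def)
      then show "open_enlargement A C {v\<in>E. fst v \<in> chart_cball c y s \<longrightarrow> snd v c \<in> \<Omega>}"
        using C\<Omega>[of s] s by (simp add: open_enlargement_def)
    qed
  qed (use r r' \<Omega> \<eta> W in auto)
qed

section \<open>Limits of recurrent curves\<close>

text \<open>The time \<open>t\<close> is the last one outside \<open>U\<close>. After it the curve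
  is in \<open>U\<close>, hence in \<open>K\<close>, and by closedness of \<open>K\<close> so is its
  position at \<open>t\<close> itself. In the applications \<open>K - U\<close> is a coordinate
  sphere.\<close>

lemma last_entry:
  fixes \<gamma> :: "real \<Rightarrow> 'a::topological_space"
  assumes \<gamma>: "continuous_on {a..b} \<gamma>" "a \<le> b" "\<gamma> a \<notin> U" "\<gamma> b \<in> U"
    and UK: "open U" "closed K" "U \<subseteq> K"
  obtains t where "a \<le> t" "t < b" "\<gamma> t \<in> K - U" "\<And>s. s \<in> {t..b} \<Longrightarrow> \<gamma> s \<in> K"
proof -
  let ?S = "{a..b} \<inter> \<gamma> -` (- U)"
  have "closed ?S" using continuous_closed_preimage[OF \<gamma>(1) closed_atLeastAtMost, of "- U"] UK(1)
    by (simp add: closed_Compl)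
  then have "compact ?S" by (simp add: compact_eq_bounded_closed bounded_Int)
  moreover have "a \<in> ?S" using \<gamma> by auto
  ultimately obtain t where t: "t \<in> ?S" "\<And>s. s \<in> ?S \<Longrightarrow> s \<le> t"
    using compact_attains_sup[of ?S] by blast
  then have "t < b" using \<gamma>(4) by (metis ComplD IntE atLeastAtMost_iff order_less_le vimageE)
  have later: "\<gamma> s \<in> U" if "s \<in> {t<..b}" for s
  proof (rule ccontr)
    assume "\<gamma> s \<notin> U"
    then have "s \<in> ?S" using that t(1) by auto
    then show False using t(2)[of s] that by auto
  qed
  have "closed ({a..b} \<inter> \<gamma> -` K)" using continuous_closed_preimage[OF \<gamma>(1) _ UK(2)] by simp
  moreover have "{t<..b} \<subseteq> {a..b} \<inter> \<gamma> -` K" using later UK(3) t(1) by fastforce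
  ultimately have "closure {t<..b} \<subseteq> {a..b} \<inter> \<gamma> -` K" by (rule closure_minimal[rotated])
  then have "{t..b} \<subseteq> {a..b} \<inter> \<gamma> -` K" using \<open>t < b\<close> by simp
  then have "\<gamma> s \<in> K" if "s \<in> {t..b}" for s using that by blast
  then show thesis using that[of t] t(1) \<open>t < b\<close> by auto
qed

text \<open>Time reversal of \<open>last_entry\<close>. The argument is kept at the level of
  continuous curves, since a reversed timelike curve is in general not timelike.\<close>

lemma first_exit:
  fixes \<gamma> :: "real \<Rightarrow> 'a::topological_space"
  assumes \<gamma>: "continuous_on {a..b} \<gamma>" "a \<le> b" "\<gamma> a \<in> U" "\<gamma> b \<notin> U"
    and UK: "open U" "closed K" "U \<subseteq> K"
  obtains t where "a < t" "t \<le> b" "\<gamma> t \<in> K - U" "\<And>s. s \<in> {a..t} \<Longrightarrow> \<gamma> s \<in> K"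
proof -
  have "continuous_on {-b..-a} (\<lambda>t. \<gamma> (- t))"
    by (rule continuous_on_compose2[OF \<gamma>(1)]) (auto intro!: continuous_intros)
  then obtain t where t: "-b \<le> t" "t < -a" "\<gamma> (- t) \<in> K - U" "\<And>s. s \<in> {t..-a} \<Longrightarrow> \<gamma> (- s) \<in> K"
    using last_entry[of "-b" "-a" "\<lambda>t. \<gamma> (- t)" U K] \<gamma> UK by auto
  show thesis
  proof (rule that[of "- t"])
    show "\<gamma> s \<in> K" if "s \<in> {a..- t}" for s using t(4)[of "- s"] that by auto
  qed (use t in auto)
qed

text \<open>The last entry may happen at the start of the curve, whence the alternative
  \<open>a = p\<close>. The final part is timelike for the field restricted to \<open>K\<close>,
  ready for \<open>chart_displacement\<close>.\<close>

lemma timelike_reach_last_entry: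
  assumes A: "smooth_atlas A" and r: "timelike_reach A E p q" and pq: "p \<notin> U" "q \<in> U"
    and UK: "open U" "closed K" "U \<subseteq> K"
  obtains a where "a \<in> K - U" "a = p \<or> timelike_reach A E p a"
    "timelike_reach A {v\<in>E. fst v \<in> K} a q"
proof -
  obtain \<gamma> s0 s1 where \<gamma>: "s0 < s1" "timelike_curve A E \<gamma> s0 s1" "\<gamma> s0 = p" "\<gamma> s1 = q"
    using r unfolding timelike_reach_def by blast
  obtain t where t: "s0 \<le> t" "t < s1" "\<gamma> t \<in> K - U" "\<And>s. s \<in> {t..s1} \<Longrightarrow> \<gamma> s \<in> K"
    using last_entry[OF timelike_curve_continuous[OF \<gamma>(2)] _ _ _ UK] \<gamma> pq by (metis less_imp_le)
  have "timelike_curve A {v\<in>E. fst v \<in> K} \<gamma> t s1"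
    by (rule timelike_curve_restrict[OF timelike_curve_subinterval[OF A \<gamma>(2) t(1,2)]]) (use t in auto)
  then have "timelike_reach A {v\<in>E. fst v \<in> K} (\<gamma> t) q"
    unfolding timelike_reach_def using t(2) \<gamma>(4) by blast
  moreover have "\<gamma> t = p \<or> timelike_reach A E p (\<gamma> t)"
    using timelike_reach_subcurve[OF A \<gamma>(2), of s0 t] t(1,2) \<gamma>(3) by (cases "t = s0") auto
  ultimately show thesis using that t(3) by blast
qed

lemma timelike_reach_first_exit:
  assumes A: "smooth_atlas A" and r: "timelike_reach A E p q" and pq: "p \<in> U" "q \<notin> U"
    and UK: "open U" "closed K" "U \<subseteq> K"
  obtains a where "a \<in> K - U" "a = q \<or> timelike_reach A E a q"
    "timelike_reach A {v\<in>E. fst v \<in> K} p a"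
proof -
  obtain \<gamma> s0 s1 where \<gamma>: "s0 < s1" "timelike_curve A E \<gamma> s0 s1" "\<gamma> s0 = p" "\<gamma> s1 = q"
    using r unfolding timelike_reach_def by blast
  obtain t where t: "s0 < t" "t \<le> s1" "\<gamma> t \<in> K - U" "\<And>s. s \<in> {s0..t} \<Longrightarrow> \<gamma> s \<in> K"
    using first_exit[OF timelike_curve_continuous[OF \<gamma>(2)] _ _ _ UK] \<gamma> pq by (metis less_imp_le)
  have "timelike_curve A {v\<in>E. fst v \<in> K} \<gamma> s0 t"
    by (rule timelike_curve_restrict[OF timelike_curve_subinterval[OF A \<gamma>(2) order_refl t(1,2)]])
      (use t in auto)
  then have "timelike_reach A {v\<in>E. fst v \<in> K} p (\<gamma> t)"
    unfolding timelike_reach_def using t(1) \<gamma>(3) by blast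
  moreover have "\<gamma> t = q \<or> timelike_reach A E (\<gamma> t) q"
    using timelike_reach_subcurve[OF A \<gamma>(2), of t s1] t(1,2) \<gamma>(4) by (cases "t = s1") auto
  ultimately show thesis using that t(3) by blast
qed

text \<open>A hyperplane separates \<open>w\<close> from \<Omega> at some level \<open>b\<close>.
  Scaling elements of \<Omega> towards 0 gives \<open>b \<le> 0\<close>, scaling them up shows that
  the form is non-negative on \<Omega>, and openness makes it positive.\<close>

lemma cvx_cone_separation:
  fixes w :: "'e::euclidean_space"
  assumes \<Omega>: "open \<Omega>" "cvx_cone \<Omega>" and w: "w \<notin> \<Omega>"
  obtains q where "\<And>v. v \<in> \<Omega> \<Longrightarrow> 0 < q \<bullet> v" "q \<bullet> w \<le> 0"
proof (cases "\<Omega> = {}")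
  case True
  then show thesis using that[of 0] by simp
next
  case False
  have conv: "convex \<Omega>" and scale: "\<And>t v. t > 0 \<Longrightarrow> v \<in> \<Omega> \<Longrightarrow> t *\<^sub>R v \<in> \<Omega>"
    using \<Omega>(2) by (auto simp: cvx_cone_def)
  obtain q b where q: "q \<noteq> 0" "q \<bullet> w \<le> b" "\<And>v. v \<in> \<Omega> \<Longrightarrow> b \<le> q \<bullet> v"
    using separating_hyperplane_sets[of "{w}" \<Omega>] conv False w by auto
  have tb: "b \<le> t * (q \<bullet> v)" if "t > 0" "v \<in> \<Omega>" for t v
    using q(3)[OF scale[OF that]] by simp
  obtain v0 where v0: "v0 \<in> \<Omega>" using False by blast
  have "((\<lambda>t. t * (q \<bullet> v0)) \<longlongrightarrow> 0 * (q \<bullet> v0)) (at_right 0)" by (intro tendsto_intros)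
  moreover have "eventually (\<lambda>t. b \<le> t * (q \<bullet> v0)) (at_right 0)"
    using tb[OF _ v0] by (auto simp: eventually_at_right_less intro: eventually_at_rightI[of 0 1])
  ultimately have "b \<le> 0" using tendsto_lowerbound by fastforce
  have nonneg: "0 \<le> q \<bullet> v" if v: "v \<in> \<Omega>" for v
  proof (rule ccontr)
    assume "\<not> 0 \<le> q \<bullet> v"
    then have neg: "q \<bullet> v < 0" by simp
    \<comment> \<open>The factor is chosen so that the form takes the value \<open>b - 1\<close> on
      the scaled vector, below the bound.\<close>
    have "b \<le> ((b - 1) / (q \<bullet> v)) * (q \<bullet> v)"
      using \<open>b \<le> 0\<close> neg v by (intro tb divide_neg_neg) auto
    then show False using neg by simp
  qed
  have "0 < q \<bullet> v" if v: "v \<in> \<Omega>" for v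
  proof -
    obtain e where e: "e > 0" "cball v e \<subseteq> \<Omega>" using \<Omega>(1) v open_contains_cball by blast
    define h where "h = e / norm q"
    have "v - h *\<^sub>R q \<in> \<Omega>" using e q(1) by (intro subsetD[OF e(2)]) (simp add: h_def dist_norm)
    from nonneg[OF this] have "h * (q \<bullet> q) \<le> q \<bullet> v" by (simp add: inner_diff_right)
    moreover have "0 < h * (q \<bullet> q)" using e(1) q(1) by (simp add: h_def)
    ultimately show ?thesis by linarith
  qed
  then show thesis using that[of q] q(2) \<open>b \<le> 0\<close> by auto
qed

text \<open>The displacement is an integral of velocities from a convex cone. Integrals are avoided:
  a form positive on \<Omega> but not on the displacement would, by the mean value theorem, increase
  along every piece.\<close>

lemma chart_displacement:
  assumes A: "smooth_atlas A" and c: "c \<in> A" and \<Omega>: "open \<Omega>" "cvx_cone \<Omega>"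
    and F: "\<And>v. v \<in> F \<Longrightarrow> fst v \<in> fst c \<and> snd v c \<in> \<Omega>"
    and r: "timelike_reach A F p q"
  shows "snd c q - snd c p \<in> \<Omega>"
proof (rule ccontr)
  assume "snd c q - snd c p \<notin> \<Omega>"
  then obtain l where l: "\<And>v. v \<in> \<Omega> \<Longrightarrow> 0 < l \<bullet> v" "l \<bullet> (snd c q - snd c p) \<le> 0"
    using cvx_cone_separation[OF \<Omega>] by metis
  obtain \<gamma> a b where \<gamma>: "a < b" "timelike_curve A F \<gamma> a b" "\<gamma> a = p" "\<gamma> b = q"
    using r unfolding timelike_reach_def by blast
  have incr: "l \<bullet> snd c (\<gamma> s) < l \<bullet> snd c (\<gamma> r)"
    if sr: "s < r" and piece: "timelike_piece A F \<gamma> s r" for s r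
  proof -
    let ?V = "\<lambda>t. snd (velocity A \<gamma> {s..r} t) c"
    have V: "\<gamma> t \<in> fst c" "?V t \<in> \<Omega>" if "t \<in> {s..r}" for t
      using F[of "velocity A \<gamma> {s..r} t"] piece that
      by (auto simp: timelike_piece_def velocity_def)
    have "\<exists>t\<in>{s<..<r}. l \<bullet> snd c (\<gamma> r) - l \<bullet> snd c (\<gamma> s) = (r - s) * (l \<bullet> ?V t)"
    proof (rule mvt_simple[OF sr])
      fix t assume "s \<le> t" "t \<le> r"
      then have "(snd c \<circ> \<gamma> has_vector_derivative ?V t) (at t within {s..r})"
        using smooth_curve_has_vector_derivative[OF A _ _ c] V(1)[of t] piece
        by (simp add: timelike_piece_def)
      then have "((\<lambda>t. l \<bullet> (snd c \<circ> \<gamma>) t) has_derivative (\<lambda>h. l \<bullet> (h *\<^sub>R ?V t))) (at t within {s..r})"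
        unfolding has_vector_derivative_def by (rule has_derivative_inner_right)
      then show "((\<lambda>t. l \<bullet> snd c (\<gamma> t)) has_derivative (\<lambda>h. h * (l \<bullet> ?V t))) (at t within {s..r})"
        by simp
    qed
    then obtain t where "t \<in> {s<..<r}" "l \<bullet> snd c (\<gamma> r) - l \<bullet> snd c (\<gamma> s) = (r - s) * (l \<bullet> ?V t)"
      by blast
    moreover from this have "0 < (r - s) * (l \<bullet> ?V t)" using l(1) V(2)[of t] sr by auto
    ultimately show ?thesis by linarith
  qed
  \<comment> \<open>The premise \<open>a < b\<close> is there because the induction starts from the
    empty chain.\<close>
  have "a < b \<longrightarrow> l \<bullet> snd c (\<gamma> a) < l \<bullet> snd c (\<gamma> b)"
    using \<gamma>(2) unfolding timelike_curve_pieces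
  proof (induction rule: piecewise_induct)
    case (step b' c')
    then show ?case
      using piecewise_le[OF step.hyps(1)] incr[OF step.hyps(2,3)] by (cases "a = b'") auto
  qed simp
  then show False using \<gamma> l(2) by (simp add: inner_diff_right)
qed

section \<open>Enlargements as a downward directed family\<close>

lemma open_enlargement_tangent_bundle:
  assumes A: "smooth_atlas A" and C: "closed_cone_field A C"
  shows "open_enlargement A C (tangent_bundle A)"
proof -
  have "fibre_coords A c x (tangent_bundle A) = UNIV" if "c \<in> A" "x \<in> fst c" for c x
    using singular_point_iff[OF A that, of "tangent_bundle A"]
    by (auto simp: singular_point_def tangent_bundle_def)
  moreover have "openin (tangent_topology A) (tangent_bundle A)"
    using topspace_tangent_topology[OF A] openin_topspace by metis
  ultimately show ?thesis
    using C by (auto simp: open_enlargement_def open_cone_field_def cone_field_def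
        closed_cone_field_def cvx_cone_def)
qed

lemma open_enlargement_Int:
  assumes A: "smooth_atlas A" and "open_enlargement A C E" "open_enlargement A C E'"
  shows "open_enlargement A C (E \<inter> E')"
proof -
  have eq: "fibre_coords A c x (E \<inter> E') = fibre_coords A c x E \<inter> fibre_coords A c x E'"
    if c: "c \<in> A" "x \<in> fst c" for c x
    using inj_onD[OF inj_on_tcoords[OF A c(1)]]
    by (intro set_eqI) (force simp: fibre_coords_iff[OF A c])
  then have "cvx_cone (fibre_coords A c x (E \<inter> E'))" if "c \<in> A" "x \<in> fst c" for c x
  proof -
    have "cvx_cone (fibre_coords A c x E)" "cvx_cone (fibre_coords A c x E')"
      using that assms(2,3) unfolding open_enlargement_def open_cone_field_def cone_field_def by blast+
    then show ?thesis using eq[OF that] cvx_cone_Int by simp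
  qed
  then show ?thesis
    using assms(2,3) by (auto simp: open_enlargement_def open_cone_field_def cone_field_def)
qed

lemma open_enlargement_finite_Int:
  assumes A: "smooth_atlas A" and C: "closed_cone_field A C"
    and "finite \<E>" "\<And>E. E \<in> \<E> \<Longrightarrow> open_enlargement A C E"
  obtains E' where "open_enlargement A C E'" "\<And>E. E \<in> \<E> \<Longrightarrow> E' \<subseteq> E"
proof -
  have "\<exists>E'. open_enlargement A C E' \<and> (\<forall>E\<in>\<E>. E' \<subseteq> E)"
    using assms(3,4)
  proof (induction \<E>)
    case empty
    then show ?case using open_enlargement_tangent_bundle[OF A C] by blast
  next
    case (insert E \<E>)
    then obtain E' where "open_enlargement A C E'" "\<forall>E\<in>\<E>. E' \<subseteq> E" by blast
    then show ?case
      using insert.prems open_enlargement_Int[OF A, of C E E'] by (intro exI[of _ "E \<inter> E'"]) auto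
  qed
  then show thesis using that by blast
qed

section \<open>From recurrence to points on a sphere\<close>

lemma chart_ball_subset_cball: "chart_ball c y s \<subseteq> chart_cball c y s"
  by (auto simp: chart_ball_def chart_cball_def)

text \<open>A closed curve can be started at any of its points: it is cut at \<open>x\<close> and
  the two parts are joined in the other order.\<close>

lemma stably_recurrent_reach:
  assumes A: "smooth_atlas A" and x: "stably_recurrent A C x" and E: "open_enlargement A C E"
  obtains \<gamma> a b where "a < b" "timelike_curve A E \<gamma> a b" "\<gamma> a = x" "\<gamma> b = x"
proof -
  obtain \<gamma> T t where \<gamma>: "T > 0" "timelike_curve A E \<gamma> 0 T" "\<gamma> 0 = \<gamma> T" "t \<in> {0..T}" "\<gamma> t = x"
    using x E unfolding stably_recurrent_def by blast
  have "timelike_reach A E x x"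
  proof (cases "t = 0 \<or> t = T")
    case True
    then show ?thesis using \<gamma> unfolding timelike_reach_def by metis
  next
    case False
    then have "timelike_reach A E (\<gamma> t) (\<gamma> T)" "timelike_reach A E (\<gamma> 0) (\<gamma> t)"
      using \<gamma>(1,4) by (auto intro!: timelike_reach_subcurve[OF A \<gamma>(2)])
    then show ?thesis using timelike_reach_trans[OF A] \<gamma>(3,5) by metis
  qed
  then show thesis using that unfolding timelike_reach_def by blast
qed

text \<open>The radius and \<Omega> come from the whole tangent bundle as enlargement and do not
  depend on \<open>E\<close>. So all enlargements give points on the same compact sphere.\<close>

lemma stably_recurrent_meets_sphere:
  assumes A: "smooth_atlas A" and C: "closed_cone_field A C"
    and c: "c \<in> A" and x: "x \<in> fst c" and ns: "\<not> singular_point A C x"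
    and rec: "stably_recurrent A C x"
  obtains r where "r > 0" "cball (snd c x) r \<subseteq> snd c ` fst c"
    "\<forall>E. open_enlargement A C E \<longrightarrow> (\<exists>a\<in>chart_cball c x r - chart_ball c x r.
       timelike_reach A E x a \<and> timelike_reach A E a x)"
proof -
  let ?T = "tangent_bundle A"
  obtain r \<Omega> \<eta> where r: "r > 0" "cball (snd c x) r \<subseteq> snd c ` fst c"
    and \<Omega>: "cvx_cone \<Omega>" "open \<Omega>" "0 \<notin> \<Omega>"
    and \<eta>: "\<eta> > 0" "\<forall>z\<in>cball (snd c x) r. \<forall>w\<in>\<Omega>. \<forall>e. norm e < \<eta> * norm w \<longrightarrow>
       (z, w + e) \<in> tcoords c ` (?T \<inter> tangent_over A c)"
    and E': "\<forall>s\<le>r. open_enlargement A C {v\<in>?T. fst v \<in> chart_cball c x s \<longrightarrow> snd v c \<in> \<Omega>}"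
    by (rule open_enlargement_neighbourhood[OF A C open_enlargement_tangent_bundle[OF A C] c x ns])
  let ?K = "chart_cball c x r" and ?U = "chart_ball c x r"
  have "\<exists>a\<in>?K - ?U. timelike_reach A E x a \<and> timelike_reach A E a x"
    if E: "open_enlargement A C E" for E
  proof -
    \<comment> \<open>Intersecting with the fixed truncated bundle confines the cones of any
      \<open>E\<close> near \<open>x\<close> to \<Omega>.\<close>
    let ?F = "E \<inter> {v\<in>?T. fst v \<in> ?K \<longrightarrow> snd v c \<in> \<Omega>}"
    have F: "open_enlargement A C ?F" using E' by (intro open_enlargement_Int[OF A E]) blast
    obtain \<gamma> a b where \<gamma>: "a < b" "timelike_curve A ?F \<gamma> a b" "\<gamma> a = x" "\<gamma> b = x"
      by (rule stably_recurrent_reach[OF A rec F])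
    have FK: "fst v \<in> fst c \<and> snd v c \<in> \<Omega>" if "v \<in> {v\<in>?F. fst v \<in> ?K}" for v
      using that by (auto simp: chart_cball_def)
    have xU: "x \<in> ?U" using x r by (simp add: chart_ball_def)
    have "\<exists>t\<in>{a..b}. \<gamma> t \<notin> ?U"
    proof (rule ccontr)
      assume "\<not> (\<exists>t\<in>{a..b}. \<gamma> t \<notin> ?U)"
      then have "timelike_curve A {v\<in>?F. fst v \<in> ?K} \<gamma> a b"
        by (intro timelike_curve_restrict[OF \<gamma>(2)] subsetD[OF chart_ball_subset_cball]) simp
      then have "timelike_reach A {v\<in>?F. fst v \<in> ?K} x x"
        unfolding timelike_reach_def using \<gamma> by blast
      from chart_displacement[OF A c \<Omega>(2,1) FK this] show False using \<Omega>(3) by simp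
    qed
    then obtain t where t: "t \<in> {a..b}" "\<gamma> t \<notin> ?U" by blast
    then have "t \<noteq> a" "t \<noteq> b" using \<gamma> xU by auto
    then have xt: "timelike_reach A ?F x (\<gamma> t)" "timelike_reach A ?F (\<gamma> t) x"
      using timelike_reach_subcurve[OF A \<gamma>(2)] t(1) \<gamma>(3,4) by force+
    \<comment> \<open>The point \<open>\<gamma> t\<close> may be far away; the last entry on the way
      back to \<open>x\<close> yields a point on the sphere itself.\<close>
    obtain p where p: "p \<in> ?K - ?U" "p = \<gamma> t \<or> timelike_reach A ?F (\<gamma> t) p"
      "timelike_reach A {v\<in>?F. fst v \<in> ?K} p x"
      by (rule timelike_reach_last_entry[OF A xt(2) t(2) xU open_chart_ball[OF A c]
            closed_chart_cball[OF A c r(2)] chart_ball_subset_cball])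
    have "timelike_reach A ?F x p" using p(2) xt(1) timelike_reach_trans[OF A] by blast
    then have "timelike_reach A E x p" by (rule timelike_reach_mono) blast
    moreover have "timelike_reach A E p x" using p(3) by (rule timelike_reach_mono) blast
    ultimately show ?thesis using p(1) by blast
  qed
  then show thesis using that r by blast
qed

section \<open>Limit points that are reached exactly\<close>

lemma closure_meets_open: "y \<in> closure S \<Longrightarrow> open U \<Longrightarrow> y \<in> U \<Longrightarrow> \<exists>a\<in>S. a \<in> U"
  using open_Int_closure_eq_empty by blast

text \<open>Over a singular point \<open>E\<close> contains the zero vector, by openness all short
  vectors over a ball, and by scaling all vectors over it. So segments in this ball are timelike in
  both directions, and they join \<open>y\<close> to a nearby \<open>a\<close>.\<close>

lemma timelike_reach_limit_singular:
  assumes A: "smooth_atlas A" and E: "open_enlargement A C E" and s: "singular_point A C y"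
    and y: "\<And>E'. open_enlargement A C E' \<Longrightarrow>
      y \<in> closure {a. timelike_reach A E' x a \<and> timelike_reach A E' a x}"
  shows "timelike_reach A E x y \<and> timelike_reach A E y x"
proof -
  obtain c where c: "c \<in> A" "y \<in> fst c" using chart_ex[OF A] .
  let ?W = "tcoords c ` (E \<inter> tangent_over A c)"
  have "fibre_coords A c y C = UNIV" using s singular_point_iff[OF A c] by blast
  moreover have "C \<subseteq> E" using E by (simp add: open_enlargement_def)
  ultimately have "(snd c y, 0) \<in> ?W" using fibre_coords_iff[OF A c, of 0 C] by blast
  moreover have "open ?W"
    using E c(1) unfolding open_enlargement_def open_cone_field_def openin_tangent_topology[OF A] by blast
  ultimately obtain S T where "open S" "open T" "(snd c y, 0) \<in> S \<times> T" "S \<times> T \<subseteq> ?W"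
    using open_prod_elim by metis
  then have ST: "open S" "open T" "snd c y \<in> S" "0 \<in> T" "S \<times> T \<subseteq> ?W" by auto
  obtain r where r: "r > 0" "ball (snd c y) r \<subseteq> S" using ST open_contains_ball by metis
  obtain e where e: "e > 0" "ball 0 e \<subseteq> T" using ST open_contains_ball by metis
  have W: "(z, u) \<in> ?W" if z: "z \<in> ball (snd c y) r" for z u
  proof -
    define h where "h = e / (norm u + 1)"
    have n: "norm u + 1 > 0" by (simp add: add_nonneg_pos)
    have h: "h > 0" using e(1) n by (simp add: h_def)
    have "h * norm u < e" using e(1) n by (simp add: h_def field_simps)
    then have "h *\<^sub>R u \<in> T" using h e(2) by auto
    then have zW: "(z, h *\<^sub>R u) \<in> ?W" using ST(5) r(2) z by blast
    then obtain p where p: "p \<in> fst c" "z = snd c p" by (auto simp: tcoords_def tangent_over_def)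
    have "cvx_cone (fibre_coords A c p E)"
      using E c(1) p(1) by (simp add: open_enlargement_def open_cone_field_def cone_field_def)
    then have "(1/h) *\<^sub>R h *\<^sub>R u \<in> fibre_coords A c p E"
      using zW h fibre_coords_iff[OF A c(1) p(1)] p(2) unfolding cvx_cone_def
      by (metis zero_less_divide_1_iff)
    then show ?thesis using fibre_coords_iff[OF A c(1) p(1)] p(2) h by simp
  qed
  have "y \<in> chart_ball c y r" using c r by (simp add: chart_ball_def)
  then obtain a where a: "a \<in> chart_ball c y r" "timelike_reach A E x a" "timelike_reach A E a x"
    using closure_meets_open[OF y[OF E] open_chart_ball[OF A c(1)]] by blast
  have ball: "convex (ball (snd c y) r)" "ball (snd c y) r \<subseteq> snd c ` fst c"
    using W[of _ 0] by (fastforce simp: tcoords_def tangent_over_def)+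
  have "timelike_reach A E a y" "timelike_reach A E y a"
    by (rule timelike_reach_chart_segment[OF A c(1) ball];
        use W a(1) c(2) r in \<open>auto simp: chart_ball_def\<close>)+
  then show ?thesis using a timelike_reach_trans[OF A] by blast
qed

text \<open>As \<open>x \<noteq> y\<close>, the ball around \<open>y\<close> can exclude
  \<open>x\<close>, so a curve between \<open>x\<close> and a point near \<open>y\<close> crosses
  the sphere. The displacement between the crossing and that point is long compared with the error
  at \<open>y\<close>, which the relative slack \<eta> absorbs.\<close>

lemma timelike_reach_limit_nonsingular:
  assumes A: "smooth_atlas A" and C: "closed_cone_field A C" and E: "open_enlargement A C E"
    and ns: "\<not> singular_point A C y" and xy: "x \<noteq> y"
    and y: "\<And>E'. open_enlargement A C E' \<Longrightarrow>
      y \<in> closure {a. timelike_reach A E' x a \<and> timelike_reach A E' a x}"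
  shows "timelike_reach A E x y \<and> timelike_reach A E y x"
proof -
  obtain c where c: "c \<in> A" "y \<in> fst c" using chart_ex[OF A] .
  obtain r \<Omega> \<eta> where r: "r > 0" "cball (snd c y) r \<subseteq> snd c ` fst c"
    and \<Omega>: "cvx_cone \<Omega>" "open \<Omega>" "0 \<notin> \<Omega>" and \<eta>: "\<eta> > 0"
    and W: "\<forall>z\<in>cball (snd c y) r. \<forall>w\<in>\<Omega>. \<forall>e. norm e < \<eta> * norm w \<longrightarrow>
       (z, w + e) \<in> tcoords c ` (E \<inter> tangent_over A c)"
    and E': "\<forall>s\<le>r. open_enlargement A C {v\<in>E. fst v \<in> chart_cball c y s \<longrightarrow> snd v c \<in> \<Omega>}"
    by (rule open_enlargement_neighbourhood[OF A C E c ns])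
  \<comment> \<open>Small enough to leave \<open>x\<close> outside the closed ball, if
    \<open>x\<close> is in the chart domain at all.\<close>
  obtain s where s: "s > 0" "s \<le> r" "x \<notin> chart_cball c y s"
  proof (cases "x \<in> fst c")
    case True
    then have "dist (snd c y) (snd c x) > 0"
      using xy c(2) inj_onD[OF chartD(3)[OF A c(1)]] by auto
    then show thesis
      using r(1) that[of "min r (dist (snd c y) (snd c x) / 2)"] by (auto simp: chart_cball_def)
  next
    case False
    then show thesis using r(1) that[of r] by (simp add: chart_cball_def)
  qed
  let ?K = "chart_cball c y s" and ?U = "chart_ball c y s"
  let ?E' = "{v\<in>E. fst v \<in> ?K \<longrightarrow> snd v c \<in> \<Omega>}"
  let ?F = "{v\<in>?E'. fst v \<in> ?K}"
  have sball: "cball (snd c y) s \<subseteq> snd c ` fst c" using r(2) s(2) subset_cball[of s r] by auto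
  note UK = open_chart_ball[OF A c(1)] closed_chart_cball[OF A c(1) sball] chart_ball_subset_cball
  have F: "fst v \<in> fst c \<and> snd v c \<in> \<Omega>" if "v \<in> ?F" for v
    using that by (auto simp: chart_cball_def)
  have displacement: "snd c q - snd c p \<in> \<Omega>" if "timelike_reach A ?F p q" for p q
    using chart_displacement[OF A c(1) \<Omega>(2,1) F that] .
  \<comment> \<open>Displacements between the sphere of radius \<open>s\<close> and a point within
    \<open>d\<close> of \<open>y\<close> have length at least \<open>s - d\<close>, so at least
    \<open>s/2\<close>. Moving that end to \<open>y\<close> changes them by less than
    \<open>d\<close>, hence by less than \<eta> times their length.\<close>
  define d where "d = min (s/2) (\<eta> * s/2)"
  have d: "d > 0" "d \<le> s/2" "d \<le> \<eta> * s/2" using s(1) \<eta> by (auto simp: d_def)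
  have "y \<in> chart_ball c y d" using c d by (simp add: chart_ball_def)
  moreover have "open_enlargement A C ?E'" using E' s(2) by blast
  ultimately obtain a where a: "a \<in> chart_ball c y d" "timelike_reach A ?E' x a" "timelike_reach A ?E' a x"
    using closure_meets_open[OF y open_chart_ball[OF A c(1)]] by blast
  have aU: "a \<in> ?U" using a(1) d(2) s(1) by (auto simp: chart_ball_def)
  have xU: "x \<notin> ?U" using s(3) chart_ball_subset_cball[of c y s] by blast
  have perturb: "(z, w + e) \<in> tcoords c ` (E \<inter> tangent_over A c)"
    if z: "z \<in> cball (snd c y) s" and w: "w \<in> \<Omega>" "s - d \<le> norm w" and e: "norm e < d" for z w e
  proof -
    have "\<eta> * (s/2) \<le> \<eta> * norm w" using w(2) d(2) \<eta> by (intro mult_left_mono) auto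
    then have "norm e < \<eta> * norm w" using e d(3) by linarith
    then show ?thesis using W w(1) z s(2) by auto
  qed
  have norm: "s - d \<le> norm (snd c a - snd c b)" "norm (snd c b - snd c a) = norm (snd c a - snd c b)"
    if "b \<in> ?K - ?U" for b
  proof -
    have "dist (snd c y) (snd c b) = s" "dist (snd c y) (snd c a) < d"
      using that a(1) by (auto simp: chart_cball_def chart_ball_def)
    then show "s - d \<le> norm (snd c a - snd c b)"
      using dist_triangle[of "snd c y" "snd c b" "snd c a"] by (simp add: dist_norm)
  qed (rule norm_minus_commute)
  have dist: "norm (snd c y - snd c a) < d" "norm (snd c a - snd c y) < d"
    using a(1) by (auto simp: chart_ball_def dist_norm norm_minus_commute)
  have seg: "timelike_reach A E p q"
    if "p \<in> ?K" "q \<in> ?K" "\<And>z. z \<in> cball (snd c y) s \<Longrightarrow>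
      (z, snd c q - snd c p) \<in> tcoords c ` (E \<inter> tangent_over A c)" for p q
    using timelike_reach_chart_segment[OF A c(1) convex_cball sball, of p q E] that
    by (simp add: chart_cball_def)
  have yK: "y \<in> ?K" using c s(1) by (simp add: chart_cball_def)
  have "timelike_reach A E x y"
  proof -
    obtain b where b: "b \<in> ?K - ?U" "b = x \<or> timelike_reach A ?E' x b" "timelike_reach A ?F b a"
      by (rule timelike_reach_last_entry[OF A a(2) xU aU UK])
    \<comment> \<open>In coordinates, the displacement \<open>a - b\<close> lies in \<Omega> and is
      corrected by the short vector \<open>y - a\<close>.\<close>
    have "(z, snd c y - snd c b) \<in> tcoords c ` (E \<inter> tangent_over A c)"
      if z: "z \<in> cball (snd c y) s" for z
      using perturb[OF z displacement[OF b(3)] norm(1)[OF b(1)] dist(1)] by simp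
    then have "timelike_reach A E b y" using seg b(1) yK by blast
    \<comment> \<open>The case \<open>b = x\<close> is excluded, as \<open>b\<close> lies in the
      closed ball and \<open>x\<close> does not.\<close>
    moreover have "timelike_reach A E x b"
      using b(1,2) s(3) by (auto intro: timelike_reach_mono)
    ultimately show ?thesis using timelike_reach_trans[OF A] by blast
  qed
  moreover have "timelike_reach A E y x"
  proof -
    obtain b where b: "b \<in> ?K - ?U" "b = x \<or> timelike_reach A ?E' b x" "timelike_reach A ?F a b"
      by (rule timelike_reach_first_exit[OF A a(3) aU xU UK])
    have "(z, snd c b - snd c y) \<in> tcoords c ` (E \<inter> tangent_over A c)"
      if z: "z \<in> cball (snd c y) s" for z
    proof -
      have "s - d \<le> norm (snd c b - snd c a)" using norm[OF b(1)] by simp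
      from perturb[OF z displacement[OF b(3)] this dist(2)] show ?thesis by simp
    qed
    then have "timelike_reach A E y b" using seg b(1) yK by blast
    moreover have "timelike_reach A E b x"
      using b(1,2) s(3) by (auto intro: timelike_reach_mono)
    ultimately show ?thesis using timelike_reach_trans[OF A] by blast
  qed
  ultimately show ?thesis ..
qed

text \<open>A finite intersection of enlargements provides one sphere point for finitely many of
  them at once, so the closures have the finite intersection property on the compact sphere. The
  sphere misses its centre \<open>x\<close>, whence \<open>y \<noteq> x\<close>.\<close>

lemma stably_recurrent_imp_reach:
  assumes A: "smooth_atlas A" and C: "closed_cone_field A C"
    and ns: "\<not> singular_point A C x" and rec: "stably_recurrent A C x"
  obtains y where "y \<noteq> x"
    "\<And>E. open_enlargement A C E \<Longrightarrow> timelike_reach A E x y \<and> timelike_reach A E y x"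
proof -
  obtain c where c: "c \<in> A" "x \<in> fst c" using chart_ex[OF A] .
  obtain r where r: "r > 0" "cball (snd c x) r \<subseteq> snd c ` fst c"
    and sphere: "\<forall>E. open_enlargement A C E \<longrightarrow> (\<exists>a\<in>chart_cball c x r - chart_ball c x r.
       timelike_reach A E x a \<and> timelike_reach A E a x)"
    by (rule stably_recurrent_meets_sphere[OF A C c ns rec])
  let ?S = "chart_cball c x r - chart_ball c x r"
  let ?Y = "\<lambda>E. {a. timelike_reach A E x a \<and> timelike_reach A E a x}"
  have "?S \<inter> (\<Inter>E\<in>{E. open_enlargement A C E}. closure (?Y E)) \<noteq> {}"
  proof (rule compact_imp_fip_image)
    show "compact ?S"
      by (intro compact_diff compact_chart_cball[OF A c(1) r(2)] open_chart_ball[OF A c(1)])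
    show "?S \<inter> (\<Inter>E\<in>\<E>. closure (?Y E)) \<noteq> {}"
      if \<E>: "finite \<E>" "\<E> \<subseteq> {E. open_enlargement A C E}" for \<E>
    proof -
      obtain E' where E': "open_enlargement A C E'" "\<And>E. E \<in> \<E> \<Longrightarrow> E' \<subseteq> E"
        using open_enlargement_finite_Int[OF A C \<E>(1)] \<E>(2) by blast
      obtain a where a: "a \<in> ?S" "timelike_reach A E' x a" "timelike_reach A E' a x"
        using sphere E'(1) by blast
      have "a \<in> closure (?Y E)" if "E \<in> \<E>" for E
        using a(2,3) timelike_reach_mono[OF _ E'(2)[OF that]] closure_subset[of "?Y E"] by blast
      then show ?thesis using a(1) by blast
    qed
  qed simp
  then obtain y where y: "y \<in> ?S" "\<And>E. open_enlargement A C E \<Longrightarrow> y \<in> closure (?Y E)"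
    by blast
  have "x \<in> chart_ball c x r" using c r by (simp add: chart_ball_def)
  then have xy: "x \<noteq> y" using y(1) by blast
  then have "timelike_reach A E x y \<and> timelike_reach A E y x" if "open_enlargement A C E" for E
    using timelike_reach_limit_singular[OF A that _ y(2)]
      timelike_reach_limit_nonsingular[OF A C that _ _ y(2)] by blast
  then show thesis using that xy by metis
qed

text \<open>The constant curve at \<open>x\<close> is timelike, because the zero vector lies in the
  full cone. It is produced as a segment with direction 0 in the convex set of one point.\<close>

lemma stably_recurrent_if_singular:
  assumes A: "smooth_atlas A" and s: "singular_point A C x"
  shows "stably_recurrent A C x"
  unfolding stably_recurrent_def
proof (intro allI impI)
  fix E assume E: "open_enlargement A C E"
  obtain c where c: "c \<in> A" "x \<in> fst c" using chart_ex[OF A] .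
  have "0 \<in> fibre_coords A c x C" using s singular_point_iff[OF A c] by blast
  then have "(snd c x + t *\<^sub>R 0, 0) \<in> tcoords c ` (E \<inter> tangent_over A c)" for t :: real
    using E unfolding fibre_coords_iff[OF A c] open_enlargement_def by auto
  then have "timelike_reach A E x x"
    by (intro timelike_reach_chart_segment[OF A c(1), of "{snd c x}"]) (use c in auto)
  then obtain \<gamma> T where "0 < T" "timelike_curve A E \<gamma> 0 T" "\<gamma> 0 = x" "\<gamma> T = x"
    by (rule timelike_reach_from[OF A])
  then show "\<exists>\<gamma> T. T > 0 \<and> timelike_curve A E \<gamma> 0 T \<and> \<gamma> 0 = \<gamma> T \<and> (\<exists>t\<in>{0..T}. \<gamma> t = x)"
    by (intro exI[of _ \<gamma>] exI[of _ T]) auto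
qed

theorem proposition1p5:
  fixes A :: "('a::{t2_space,second_countable_topology}, 'e::euclidean_space) chart set"
    and g :: "('a, 'e) tvec \<Rightarrow> ('a, 'e) tvec \<Rightarrow> real"
    and C :: "('a, 'e) tvec set"
    and x :: 'a
  assumes "complete_riemannian_manifold A g"
    and "closed_cone_field A C"
  shows "stably_recurrent A C x \<longleftrightarrow>
    singular_point A C x \<or> (\<exists>y. y \<noteq> x \<and> y \<in> stable_future A C x \<inter> stable_past A C x)"
proof -
  have A: "smooth_atlas A" using assms(1) by (simp add: complete_riemannian_manifold_def)
  \<comment> \<open>For \<open>y \<noteq> x\<close> the point \<open>x\<close> that is added to the
    stable sets drops out, and non-constancy of the curves is automatic.\<close>
  have iff: "y \<in> stable_future A C x \<inter> stable_past A C x \<longleftrightarrow>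
      (\<forall>E. open_enlargement A C E \<longrightarrow> timelike_reach A E x y \<and> timelike_reach A E y x)"
    if "y \<noteq> x" for y
    using that chron_future_iff[OF A that] chron_future_iff[OF A that[symmetric]]
    by (auto simp: stable_future_def stable_past_def chron_past_def)
  show ?thesis
  proof
    assume "stably_recurrent A C x"
    then show "singular_point A C x \<or> (\<exists>y. y \<noteq> x \<and> y \<in> stable_future A C x \<inter> stable_past A C x)"
      using stably_recurrent_imp_reach[OF A assms(2)] iff by metis
  next
    assume "singular_point A C x \<or> (\<exists>y. y \<noteq> x \<and> y \<in> stable_future A C x \<inter> stable_past A C x)"
    then show "stably_recurrent A C x"
    proof (elim disjE exE conjE)
      fix y assume y: "y \<noteq> x" "y \<in> stable_future A C x \<inter> stable_past A C x"
      show ?thesis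
        unfolding stably_recurrent_def
      proof (intro allI impI)
        fix E assume "open_enlargement A C E"
        then have "timelike_reach A E x x" using iff[OF y(1)] y(2) timelike_reach_trans[OF A] by blast
        then obtain \<gamma> T where "0 < T" "timelike_curve A E \<gamma> 0 T" "\<gamma> 0 = x" "\<gamma> T = x"
          by (rule timelike_reach_from[OF A])
        then show "\<exists>\<gamma> T. T > 0 \<and> timelike_curve A E \<gamma> 0 T \<and> \<gamma> 0 = \<gamma> T \<and> (\<exists>t\<in>{0..T}. \<gamma> t = x)"
          by (intro exI[of _ \<gamma>] exI[of _ T]) auto
      qed
    qed (rule stably_recurrent_if_singular[OF A])
  qed
qed

end
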